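(* Let $\kappa\ge2$ be an integer. There exists a universal constant $C=C(\kappa)>0$ such that for any $\ell\ge1$ and any local function $f:\Omega\to\mathbb{R}$ supported in $\{0,\dots,\ell-1\}$ with $\psi_f(\rho,\mathcal{E})=0$ for any $\rho\in[0,1]$ and $\mathcal{E}\in[\rho,\kappa\rho]$, one has $$\mathrm{Var}_{\rho,\mathcal{E}}(f)\le C\ell^2\sum_{\substack{x,y\in\{0,\dots,\ell-1\}\\|x-y|=1}}\Big(\mathfrak{D}^p_{x\to y}(f;\mu_{\rho,\mathcal{E}})+\mathfrak{D}^e_{x\to y}(f;\mu_{\rho,\mathcal{E}})\Big).$$
   Context: $\Omega=\{0,1,\dots,\kappa\}^{\mathbb{Z}}$; for $\eta\in\Omega$, $\xi_x=\mathbf 1_{\{\eta_x\ge1\}}$. A function supported in $\{0,\dots,\ell-1\}$ depends only on $\eta_0,\dots,\eta_{\ell-1}$. $\eta^{x,y}$ is $\eta$ with the values at $x$ and $y$ exchanged; $\eta^{x\to y}$ is $\eta$ with $\eta_x$ replaced by $\eta_x-1$ and $\eta_y$ by $\eta_y+1$ (only used when the rate below is non-zero). Rates: $c^p_{x\to y}(\eta)=(\kappa-1)\xi_x(1-\xi_y)$, $c^e_{x\to y}(\eta)=\xi_x\xi_y(\eta_x-1)(\kappa-\eta_y)$. For $\rho\in[0,1]$, $\mathcal{E}\in[\rho,\kappa\rho]$, $\mu_{\rho,\mathcal{E}}$ is the product measure on $\Omega$ whose marginal has mass $1-\rho$ at $0$ and $\rho\binom{\kappa-1}{k-1}\mathtt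 p^{k-1}(1-\mathtt p)^{\kappa-k}$ at $k\in\{1,\dots,\kappa\}$, with $\mathtt p=\frac{\mathcal{E}/\rho-1}{\kappa-1}$ (for $\rho=0$, the Dirac mass at the empty configuration). $\mathbb{E}_{\rho,\mathcal{E}}$, $\mathrm{Var}_{\rho,\mathcal{E}}$ are expectation and variance under $\mu_{\rho,\mathcal{E}}$, and $\psi_f(\rho,\mathcal{E})=\mathbb{E}_{\rho,\mathcal{E}}[f]$. Dirichlet forms: $$\mathfrak{D}^p_{x\to y}(f;\mu)=\tfrac12\int_\Omega c^p_{x\to y}(\eta)[f(\eta^{x,y})-f(\eta)]^2d\mu(\eta),\qquad \mathfrak{D}^e_{x\to y}(f;\mu)=\tfrac12\int_\Omega c^e_{x\to y}(\eta)[f(\eta^{x\to y})-f(\eta)]^2d\mu(\eta).$$ *)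

theory Defs
  imports "HOL-Probability.Probability"
begin

type_synonym config = "int \<Rightarrow> nat"

definition configs :: "nat \<Rightarrow> config set" where
  "configs \<kappa> = {\<eta>. \<forall>x. \<eta> x \<le> \<kappa>}"

definition occ :: "config \<Rightarrow> int \<Rightarrow> real" where
  "occ \<eta> x = of_bool (\<eta> x \<ge> 1)"

definition swap_config :: "config \<Rightarrow> int \<Rightarrow> int \<Rightarrow> config" where
  "swap_config \<eta> x y = \<eta>(x := \<eta> y, y := \<eta> x)"

text \<open>For \<^term>\<open>x \<noteq> y\<close> only. If the rate \<open>rate_e\<close> below is non-zero, then \<^term>\<open>\<eta> x \<ge> 2\<close>
  and \<^term>\<open>\<eta> y < \<kappa>\<close>, so the subtraction does not truncate and the result stays
  in \<open>configs \<kappa>\<close>.\<close>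
definition move_config :: "config \<Rightarrow> int \<Rightarrow> int \<Rightarrow> config" where
  "move_config \<eta> x y = \<eta>(x := \<eta> x - 1, y := \<eta> y + 1)"

definition rate_p :: "nat \<Rightarrow> config \<Rightarrow> int \<Rightarrow> int \<Rightarrow> real" where
  "rate_p \<kappa> \<eta> x y = (real \<kappa> - 1) * occ \<eta> x * (1 - occ \<eta> y)"

definition rate_e :: "nat \<Rightarrow> config \<Rightarrow> int \<Rightarrow> int \<Rightarrow> real" where
  "rate_e \<kappa> \<eta> x y = occ \<eta> x * occ \<eta> y * (real (\<eta> x) - 1) * (real \<kappa> - real (\<eta> y))"

definition energy_param :: "nat \<Rightarrow> real \<Rightarrow> real \<Rightarrow> real" where
  "energy_param \<kappa> \<rho> \<E> = (\<E> / \<rho> - 1) / (real \<kappa> - 1)"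

text \<open>For \<^term>\<open>\<rho> = (0::real)\<close> every weight at \<^term>\<open>k \<ge> 1\<close> carries the factor \<^term>\<open>\<rho>\<close>, whatever the value
  of \<^const>\<open>energy_param\<close>, so the marginal is the Dirac mass at 0.\<close>
definition site_weight :: "nat \<Rightarrow> real \<Rightarrow> real \<Rightarrow> nat \<Rightarrow> real" where
  "site_weight \<kappa> \<rho> \<E> k =
     (if k = 0 then 1 - \<rho>
      else \<rho> * real ((\<kappa> - 1) choose (k - 1))
             * energy_param \<kappa> \<rho> \<E> ^ (k - 1) * (1 - energy_param \<kappa> \<rho> \<E>) ^ (\<kappa> - k))"

text \<open>The underlying space of this measure is exactly \<^term>\<open>configs \<kappa>\<close>.\<close>
definition prod_meas :: "nat \<Rightarrow> real \<Rightarrow> real \<Rightarrow> config measure" where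
  "prod_meas \<kappa> \<rho> \<E> = PiM UNIV (\<lambda>_. point_measure {0..\<kappa>} (\<lambda>k. ennreal (site_weight \<kappa> \<rho> \<E> k)))"

definition supported_in :: "nat \<Rightarrow> int set \<Rightarrow> (config \<Rightarrow> real) \<Rightarrow> bool" where
  "supported_in \<kappa> A f \<longleftrightarrow>
     (\<forall>\<eta>\<in>configs \<kappa>. \<forall>\<zeta>\<in>configs \<kappa>. (\<forall>x\<in>A. \<eta> x = \<zeta> x) \<longrightarrow> f \<eta> = f \<zeta>)"

definition psi :: "nat \<Rightarrow> (config \<Rightarrow> real) \<Rightarrow> real \<Rightarrow> real \<Rightarrow> real" where
  "psi \<kappa> f \<rho> \<E> = prob_space.expectation (prod_meas \<kappa> \<rho> \<E>) f"

definition dirichlet_p :: "nat \<Rightarrow> config measure \<Rightarrow> (config \<Rightarrow> real) \<Rightarrow> int \<Rightarrow> int \<Rightarrow> real" where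
  "dirichlet_p \<kappa> \<mu> f x y =
     1/2 * (LINT \<eta>|\<mu>. rate_p \<kappa> \<eta> x y * (f (swap_config \<eta> x y) - f \<eta>)\<^sup>2)"

definition dirichlet_e :: "nat \<Rightarrow> config measure \<Rightarrow> (config \<Rightarrow> real) \<Rightarrow> int \<Rightarrow> int \<Rightarrow> real" where
  "dirichlet_e \<kappa> \<mu> f x y =
     1/2 * (LINT \<eta>|\<mu>. rate_e \<kappa> \<eta> x y * (f (move_config \<eta> x y) - f \<eta>)\<^sup>2)"

end

theory Submission
  imports Defs
begin

text \<open>Since all the expectations vanish, \<open>f\<close> has mean zero on every class of configurations with a given
  number of particles and a given total energy. An occupied site with energy \<open>k\<close> is viewed as
  \<open>m = \<kappa> - 1\<close> subsites of which \<open>k - 1\<close> are filled; the binomial marginals become uniform measures, and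
  the energy exchanges become transpositions of subsites. The spectral gap of the random transposition walk is
  then used twice: on the subsites of a fixed set of particles, which replaces \<open>f\<close> by its average
  over the energies, and on the sites, which handles the dependence of this average on the positions.

  It remains to replace long-range moves by nearest neighbour ones. Exchanging the contents of two
  neighbouring sites is controlled by the two Dirichlet forms, because two neighbouring particles can swap
  their energies by energy exchanges alone. Long-range exchanges of contents are products of such swaps,
  at a cost proportional to the distance. A long-range energy exchange between \<open>x < y\<close> carries a weight
  \<open>1 / N\<close>, where \<open>N\<close> is the number of particles up to \<open>y\<close>; it is performed by bringing the content of \<open>y\<close>
  next to \<open>x\<close>, and the weight compensates the number of particles \<open>x\<close> available, so that no density
  factor is lost.\<close>

section \<open>Random transpositions\<close>

hide_const (open) Finite_Cartesian_Product.transpose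
hide_fact (open) Finite_Cartesian_Product.transpose_def

text \<open>The constant is uniform in \<rho> and \<E> because they hardly enter: every inequality
  is proved for a weight \<open>\<phi> N E * mult \<eta>\<close> with an arbitrary nonnegative
  \<open>\<phi>\<close>, so only \<open>m\<close> and \<open>l\<close> can appear. The measure comes
  in at the end, when \<open>\<phi>\<close> becomes \<open>class_weight\<close>. There the vanishing
  of all expectations is read as the vanishing of a polynomial in two variables (a fugacity for
  particles and one for energy), whose coefficients are the class sums of \<open>f\<close>. The gap
  is used in a form with unequal weights: the pair i < k has weight 1 / (2 * card {i. i \<le> k}).
  For positions this denominator absorbs the length of the path between the two sites. For energies
  it only counts particles, and these may be few compared with the length of the path. Forgetting
  during the transport that \<open>x\<close> must be occupied would leave one term for each site
  instead of each particle, hence a loss of order l / N. So the path has to avoid \<open>x\<close>,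
  which is why the transport takes place in \<open>{x<..y}\<close> under a weight that remembers
  \<open>x\<close>. The factor \<open>m\<close>^2 in the constant is the largest value of the energy
  rate.\<close>

definition perm_avg :: "'i set \<Rightarrow> (('i \<Rightarrow> 'v) \<Rightarrow> real) \<Rightarrow> ('i \<Rightarrow> 'v) \<Rightarrow> real" where
  "perm_avg J f x = (\<Sum>p | p permutes J. f (x \<circ> p)) / fact (card J)"

lemma perm_avg_empty [simp]: "perm_avg {} f = f"
  by (rule ext) (simp add: perm_avg_def)

lemma perm_avg_comp:
  assumes "q permutes J"
  shows "perm_avg J f (x \<circ> q) = perm_avg J f x"
  using setum_permutations_compose_left[OF assms, of "\<lambda>p. f (x \<circ> p)"]
  by (simp add: perm_avg_def o_assoc)

text \<open>Coset decomposition: each permutation of \<open>insert b J\<close> is uniquely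
  \<open>transpose b i \<circ> q\<close> with \<open>i\<close> in \<open>insert b J\<close> and
  \<open>q\<close> permuting \<open>J\<close>.\<close>

lemma perm_avg_insert:
  assumes "finite J" "b \<notin> J"
  shows "perm_avg (insert b J) f x = (\<Sum>i\<in>insert b J. perm_avg J f (x \<circ> transpose b i)) / (card J + 1)"
proof -
  have "perm_avg (insert b J) f x
      = (\<Sum>i\<in>insert b J. \<Sum>q | q permutes J. f (x \<circ> transpose b i \<circ> q)) / fact (card J + 1)"
    using assms by (simp add: perm_avg_def sum_over_permutations_insert o_assoc)
  also have "\<dots> = (\<Sum>i\<in>insert b J. perm_avg J f (x \<circ> transpose b i)) / (card J + 1)"
    by (simp add: perm_avg_def flip: sum_divide_distrib)
  finally show ?thesis .
qed

lemma average_power2_le: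
  fixes a :: "'b \<Rightarrow> real"
  assumes "finite A"
  shows "((\<Sum>p\<in>A. a p) / card A)\<^sup>2 \<le> (\<Sum>p\<in>A. (a p)\<^sup>2) / card A"
proof (cases "A = {}")
  case False
  then have "0 < real (card A)" using assms by (simp add: card_gt_0_iff)
  then show ?thesis
    using sum_squared_le_sum_of_squares[of a A] by (simp add: field_simps power2_eq_square)
qed simp

locale perm_weight =
  fixes I :: "'i set" and X :: "('i \<Rightarrow> 'v) set" and w :: "('i \<Rightarrow> 'v) \<Rightarrow> real"
  assumes finite_I: "finite I" and finite_X: "finite X"
    and w_nonneg: "x \<in> X \<Longrightarrow> 0 \<le> w x"
    and X_closed: "p permutes I \<Longrightarrow> x \<in> X \<Longrightarrow> x \<circ> p \<in> X"
    and w_inv: "p permutes I \<Longrightarrow> x \<in> X \<Longrightarrow> w (x \<circ> p) = w x"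
begin

definition variation :: "(('i \<Rightarrow> 'v) \<Rightarrow> real) \<Rightarrow> ('i \<Rightarrow> 'i) \<Rightarrow> real" where
  "variation f p = (\<Sum>x\<in>X. w x * (f x - f (x \<circ> p))\<^sup>2)"

lemma variation_nonneg: "0 \<le> variation f p"
  by (auto simp: variation_def intro!: sum_nonneg mult_nonneg_nonneg w_nonneg)

lemma variation_id [simp]: "variation f id = 0" "variation f (\<lambda>x. x) = 0"
  by (simp_all add: variation_def o_def)

lemma sum_comp_perm:
  assumes "p permutes I"
  shows "(\<Sum>x\<in>X. w x * h (x \<circ> p)) = (\<Sum>x\<in>X. w x * h x)"
  by (rule sum.reindex_bij_witness[of _ "\<lambda>x. x \<circ> inv p" "\<lambda>x. x \<circ> p"])
     (use assms in \<open>auto simp: X_closed w_inv permutes_inv o_assoc[symmetric] permutes_inv_o\<close>)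

text \<open>\<open>perm_avg J\<close> acts as the conditional expectation onto functions invariant
  under \<open>J\<close>: by invariance of the weight, \<open>p\<close> can be moved from
  \<open>f\<close> to \<open>g\<close>, which absorbs it.\<close>

lemma sum_perm_avg_mult:
  assumes "J \<subseteq> I" and g: "\<And>p x. p permutes J \<Longrightarrow> x \<in> X \<Longrightarrow> g (x \<circ> p) = g x"
  shows "(\<Sum>x\<in>X. w x * (perm_avg J f x * g x)) = (\<Sum>x\<in>X. w x * (f x * g x))"
proof -
  have fin: "finite J" using assms finite_I finite_subset by blast
  have "(\<Sum>x\<in>X. w x * (perm_avg J f x * g x))
      = (\<Sum>p | p permutes J. \<Sum>x\<in>X. w x * (f (x \<circ> p) * g x)) / fact (card J)"
    by (subst sum.swap)
       (simp add: perm_avg_def sum_divide_distrib sum_distrib_left sum_distrib_right)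
  also have "\<dots> = (\<Sum>p | p permutes J. \<Sum>x\<in>X. w x * (f x * g x)) / fact (card J)"
  proof -
    have "(\<Sum>x\<in>X. w x * (f (x \<circ> p) * g x)) = (\<Sum>x\<in>X. w x * (f x * g x))" if "p permutes J" for p
    proof -
    have p: "p permutes J" "p permutes I" using that assms permutes_subset by auto
    have "(\<Sum>x\<in>X. w x * (f (x \<circ> p) * g x)) = (\<Sum>x\<in>X. w x * (f (x \<circ> p) * g (x \<circ> p)))"
      using g p by (intro sum.cong) auto
    then show ?thesis 
      using sum_comp_perm[OF p(2), of "\<lambda>x. f x * g x"] by simp
    qed
    then show ?thesis by - (rule arg_cong[where f="\<lambda>s. s / fact (card J)"], rule sum.cong, auto)
  qed
  finally show ?thesis using fin by (simp add: card_permutations)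
qed

lemma sum_perm_avg:
  assumes "J \<subseteq> I"
  shows "(\<Sum>x\<in>X. w x * perm_avg J f x) = (\<Sum>x\<in>X. w x * f x)"
  using sum_perm_avg_mult[OF assms, of "\<lambda>_. 1"] by simp

lemma variation_comp:
  assumes "p permutes I"
  shows "(\<Sum>x\<in>X. w x * (f (x \<circ> p) - f (x \<circ> p \<circ> q))\<^sup>2) = variation f q"
  using sum_comp_perm[OF assms, of "\<lambda>x. (f x - f (x \<circ> q))\<^sup>2"] by (simp add: variation_def)

text \<open>Moving \<open>p\<close> past the transposition of \<open>b\<close> and \<open>i\<close>
  turns it into that of \<open>b\<close> and \<open>inv p i\<close>. After Jensen, \<open>p\<close>
  therefore only permutes the indices, and the sum over all of \<open>J\<close> is unchanged; the
  terms are not compared one by one.\<close>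

lemma variation_perm_avg_le:
  assumes J: "J \<subseteq> I" "b \<in> I" "b \<notin> J"
  shows "(\<Sum>i\<in>J. variation (perm_avg J f) (transpose b i)) \<le> (\<Sum>i\<in>J. variation f (transpose b i))"
proof -
  have fin: "finite J" using assms finite_I finite_subset by blast
  have finP: "finite {p. p permutes J}" using fin finite_permutations by blast
  let ?P = "{p. p permutes J}"
  let ?n = "fact (card J) :: real"
  have cardP: "real (card ?P) = ?n" using fin by (simp add: card_permutations)
  have comp: "transpose b i \<circ> p = p \<circ> transpose b (inv p i)" if "p permutes J" for p i
  proof
    fix a
    have "p b = b" using that J(3) by (simp add: permutes_def)
    moreover have "p (inv p i) = i"
      using that by (simp add: permutes_inverses)
    moreover have "p a = b \<longleftrightarrow> a = b" "p a = i \<longleftrightarrow> a = inv p i"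
      using that \<open>p b = b\<close> by (metis permutes_inverses)+
    ultimately show "(transpose b i \<circ> p) a = (p \<circ> transpose b (inv p i)) a"
      by (auto simp: transpose_def)
  qed
  have pt: "(perm_avg J f x - perm_avg J f (x \<circ> transpose b i))\<^sup>2
      \<le> (\<Sum>p\<in>?P. (f (x \<circ> p) - f (x \<circ> p \<circ> transpose b (inv p i)))\<^sup>2) / ?n" for x i
  proof -
    have "perm_avg J f x - perm_avg J f (x \<circ> transpose b i)
        = (\<Sum>p\<in>?P. f (x \<circ> p) - f (x \<circ> p \<circ> transpose b (inv p i))) / card ?P"
      unfolding perm_avg_def cardP diff_divide_distrib[symmetric] sum_subtractf[symmetric]
      by (intro arg_cong2[of _ _ _ _ "(/)"] sum.cong refl) (simp add: comp o_assoc[symmetric])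
    then show ?thesis
      using average_power2_le[OF finP, of "\<lambda>p. f (x \<circ> p) - f (x \<circ> p \<circ> transpose b (inv p i))"]
      by (simp only: cardP)
  qed
  have "(\<Sum>i\<in>J. variation (perm_avg J f) (transpose b i))
      \<le> (\<Sum>i\<in>J. \<Sum>x\<in>X. w x * ((\<Sum>p\<in>?P. (f (x \<circ> p) - f (x \<circ> p \<circ> transpose b (inv p i)))\<^sup>2) / ?n))"
    unfolding variation_def by (intro sum_mono mult_left_mono pt w_nonneg)
  also have "\<dots> = (\<Sum>p\<in>?P. \<Sum>i\<in>J. \<Sum>x\<in>X. w x * (f (x \<circ> p) - f (x \<circ> p \<circ> transpose b (inv p i)))\<^sup>2) / ?n"
    by (subst (3) sum.swap, subst (2) sum.swap) (simp add: sum_divide_distrib sum_distrib_left)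
  also have "\<dots> = (\<Sum>p\<in>?P. \<Sum>i\<in>J. variation f (transpose b i)) / ?n"
  proof -
    have "(\<Sum>i\<in>J. \<Sum>x\<in>X. w x * (f (x \<circ> p) - f (x \<circ> p \<circ> transpose b (inv p i)))\<^sup>2)
        = (\<Sum>i\<in>J. variation f (transpose b i))" if "p permutes J" for p
    proof -
    have p: "p permutes J" "p permutes I" using that J permutes_subset by auto
    have "(\<Sum>i\<in>J. \<Sum>x\<in>X. w x * (f (x \<circ> p) - f (x \<circ> p \<circ> transpose b (inv p i)))\<^sup>2)
        = (\<Sum>i\<in>J. variation f (transpose b (inv p i)))"
      by (simp add: variation_comp[OF p(2)])
    also have "\<dots> = (\<Sum>i\<in>J. variation f (transpose b i))"
      using sum.permute[OF permutes_inv[OF p(1)], of "\<lambda>i. variation f (transpose b i)"]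
      by (simp add: o_def)
    finally show ?thesis .
    qed
    then show ?thesis by - (rule arg_cong[where f="\<lambda>s. s / fact (card J)"], rule sum.cong, auto)
  qed
  finally show ?thesis using cardP by simp
qed

text \<open>The new average is the mean of \<open>card J + 1\<close> transposed copies of the old
  one, so the loss of second moment is exactly the sum of the variations of
  \<open>perm_avg J f\<close>, divided by \<open>2 * (card J + 1)\<close>. Then
  \<open>variation_perm_avg_le\<close> replaces that average by \<open>f\<close>.\<close>

lemma perm_avg_insert_energy:
  assumes J: "J \<subseteq> I" "b \<in> I" "b \<notin> J"
  shows "(\<Sum>x\<in>X. w x * (perm_avg J f x)\<^sup>2) \<le> (\<Sum>x\<in>X. w x * (perm_avg (insert b J) f x)\<^sup>2)
    + (\<Sum>i\<in>J. variation f (transpose b i)) / (2 * (card J + 1))"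
proof -
  have fin: "finite J" using assms finite_I finite_subset by blast
  define g h where "g = perm_avg J f" and "h = perm_avg (insert b J) f"
  have ginv: "g (x \<circ> p) = g x" if "p permutes J" for p x
    using that by (simp add: g_def perm_avg_comp)
  have hinv: "h (x \<circ> p) = h x" if "p permutes insert b J" for p x
    using that by (simp add: h_def perm_avg_comp)
  have hinvJ: "h (x \<circ> p) = h x" if "p permutes J" for p x
    using that hinv permutes_subset by blast
  \<comment> \<open>Tower property: \<open>h\<close> is invariant under permutations of
    \<open>J\<close> as well, so it has the same inner product with \<open>h\<close>,
    \<open>f\<close> and \<open>g\<close>.\<close>
  have "(\<Sum>x\<in>X. w x * (h x * h x)) = (\<Sum>x\<in>X. w x * (f x * h x))"
    using sum_perm_avg_mult[of "insert b J" h f] J hinv by (simp add: h_def)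
  also have "\<dots> = (\<Sum>x\<in>X. w x * (g x * h x))"
    using sum_perm_avg_mult[of J h f] J hinvJ by (simp add: g_def)
  finally have hh: "(\<Sum>x\<in>X. w x * (h x)\<^sup>2) = (\<Sum>x\<in>X. w x * (g x * h x))"
    by (simp add: power2_eq_square)
  have heq: "h x = (\<Sum>i\<in>insert b J. g (x \<circ> transpose b i)) / (card J + 1)" for x
    unfolding h_def g_def using fin J by (intro perm_avg_insert) auto
  have var: "variation g (transpose b i)
     = 2 * (\<Sum>x\<in>X. w x * (g x)\<^sup>2) - 2 * (\<Sum>x\<in>X. w x * (g x * g (x \<circ> transpose b i)))"
    if "i \<in> insert b J" for i
  proof -
    have "transpose b i permutes I" using that J by (intro permutes_swap_id) auto
    then have eq: "(\<Sum>x\<in>X. w x * (g (x \<circ> transpose b i))\<^sup>2) = (\<Sum>x\<in>X. w x * (g x)\<^sup>2)"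
      by (rule sum_comp_perm[of _ "\<lambda>x. (g x)\<^sup>2"])
    have "variation g (transpose b i) = (\<Sum>x\<in>X. w x * (g x)\<^sup>2)
       + (\<Sum>x\<in>X. w x * (g (x \<circ> transpose b i))\<^sup>2) - 2 * (\<Sum>x\<in>X. w x * (g x * g (x \<circ> transpose b i)))"
      unfolding variation_def sum_distrib_left sum.distrib[symmetric] sum_subtractf[symmetric]
      by (intro sum.cong refl) (simp add: power2_eq_square algebra_simps)
    then show ?thesis using eq by simp
  qed
  have "(card J + 1) * (\<Sum>x\<in>X. w x * (h x)\<^sup>2)
      = (\<Sum>i\<in>insert b J. \<Sum>x\<in>X. w x * (g x * g (x \<circ> transpose b i)))"
  proof -
    have "(card J + 1) * (g x * h x) = (\<Sum>i\<in>insert b J. g x * g (x \<circ> transpose b i))" for x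
      unfolding heq by (simp add: sum_distrib_left field_simps)
    then have "(card J + 1) * (w x * (g x * h x))
        = (\<Sum>i\<in>insert b J. w x * (g x * g (x \<circ> transpose b i)))" for x
      by (metis mult.left_commute sum_distrib_left)
    then show ?thesis
      unfolding hh by (subst sum.swap) (simp only: sum_distrib_left)
  qed
  also have "\<dots> = (\<Sum>i\<in>insert b J. (\<Sum>x\<in>X. w x * (g x)\<^sup>2) - variation g (transpose b i) / 2)"
    by (intro sum.cong refl) (simp add: var diff_divide_distrib)
  also have "\<dots> = (card J + 1) * (\<Sum>x\<in>X. w x * (g x)\<^sup>2) - (\<Sum>i\<in>insert b J. variation g (transpose b i)) / 2"
    using fin J by (simp add: sum_subtractf sum_divide_distrib)
  finally have "(card J + 1) * (\<Sum>x\<in>X. w x * (g x)\<^sup>2) = (card J + 1) * (\<Sum>x\<in>X. w x * (h x)\<^sup>2)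
      + (\<Sum>i\<in>J. variation g (transpose b i)) / 2"
    using fin J by simp
  moreover have "(\<Sum>i\<in>J. variation g (transpose b i)) \<le> (\<Sum>i\<in>J. variation f (transpose b i))"
    unfolding g_def by (rule variation_perm_avg_le) (use J in auto)
  ultimately show ?thesis
    unfolding g_def[symmetric] h_def[symmetric] by (simp add: field_simps)
qed

end

text \<open>Averaging over the permutations of a growing initial segment of the index set is a reverse
  martingale, and its increments are controlled by the transpositions with the new index.\<close>
lemma transposition_gap:
  fixes I :: "'i::linorder set"
  assumes "perm_weight I X w" "A \<subseteq> I"
  shows "(\<Sum>x\<in>X. w x * (f x)\<^sup>2) \<le> (\<Sum>x\<in>X. w x * (perm_avg A f x)\<^sup>2)
    + (\<Sum>k\<in>A. (\<Sum>i\<in>{i\<in>A. i < k}. perm_weight.variation X w f (transpose k i)) / (2 * card {i\<in>A. i \<le> k}))"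
proof -
  interpret perm_weight I X w by fact
  have "finite A" using assms finite_I finite_subset by blast
  then show ?thesis using \<open>A \<subseteq> I\<close>
  proof (induction A rule: finite_linorder_max_induct)
    case empty
    then show ?case by simp
  next
    case (insert b A)
    then have b: "b \<notin> A" by auto
    have e1: "{i \<in> insert b A. i < b} = A" "{i \<in> insert b A. i \<le> b} = insert b A"
      using insert by auto
    have e2: "{i \<in> insert b A. i < k} = {i\<in>A. i < k}" "{i \<in> insert b A. i \<le> k} = {i\<in>A. i \<le> k}"
      if "k \<in> A" for k
      using insert that by auto
    let ?D = "\<lambda>A k. (\<Sum>i\<in>{i\<in>A. i < k}. variation f (transpose k i)) / (2 * card {i\<in>A. i \<le> k})"
    have "(\<Sum>k\<in>insert b A. ?D (insert b A) k) = ?D (insert b A) b + (\<Sum>k\<in>A. ?D (insert b A) k)"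
      using insert.hyps b by simp
    also have "(\<Sum>k\<in>A. ?D (insert b A) k) = (\<Sum>k\<in>A. ?D A k)"
      by (intro sum.cong refl) (simp only: e2)
    also have "?D (insert b A) b = (\<Sum>i\<in>A. variation f (transpose b i)) / (2 * (card A + 1))"
      unfolding e1 using insert.hyps b by simp
    finally show ?case
      using insert.IH insert.prems perm_avg_insert_energy[of A b f] b by simp
  qed
qed

context perm_weight
begin

text \<open>Triangle inequality in weighted L2 through the intermediate point
  \<open>x \<circ> p\<close>; invariance of the weight identifies the second increment with
  \<open>variation f q\<close>.\<close>

lemma variation_sqrt_triangle:
  assumes "p permutes I" 
  shows "sqrt (variation f (p \<circ> q)) \<le> sqrt (variation f p) + sqrt (variation f q)"
proof -
  have L: "sqrt (\<Sum>x\<in>X. w x * (g x)\<^sup>2) = L2_set (\<lambda>x. sqrt (w x) * g x) X" for g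
    unfolding L2_set_def by (simp add: power_mult_distrib w_nonneg cong: sum.cong)
  have "sqrt (variation f (p \<circ> q))
      = L2_set (\<lambda>x. sqrt (w x) * (f x - f (x \<circ> p)) + sqrt (w x) * (f (x \<circ> p) - f (x \<circ> p \<circ> q))) X"
    unfolding variation_def L by (simp add: o_assoc algebra_simps)
  also have "\<dots> \<le> L2_set (\<lambda>x. sqrt (w x) * (f x - f (x \<circ> p))) X
      + L2_set (\<lambda>x. sqrt (w x) * (f (x \<circ> p) - f (x \<circ> p \<circ> q))) X"
    by (rule L2_set_triangle_ineq)
  also have "\<dots> = sqrt (variation f p) + sqrt (variation f q)"
    using variation_comp[OF assms, of f q] unfolding L[symmetric] by (simp add: variation_def)
  finally show ?thesis .
qed

end

text \<open>A transposition is lengthened by one step through conjugation with a neighbour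
  transposition, so each neighbour occurs at most twice. Squaring gives 2^2 and Cauchy-Schwarz a
  further \<open>d\<close>.\<close>

lemma variation_transpose_path:
  fixes u :: int
  assumes "perm_weight {u..u + int d} X w"
  shows "perm_weight.variation X w f (transpose u (u + int d))
    \<le> 4 * d * (\<Sum>j<d. perm_weight.variation X w f (transpose (u + int j) (u + int j + 1)))"
proof -
  interpret perm_weight "{u..u + int d}" X w by fact
  have "sqrt (variation f (transpose u (u + int k)))
      \<le> 2 * (\<Sum>j<k. sqrt (variation f (transpose (u + int j) (u + int j + 1))))" if "k \<le> d" for k
    using that
  proof (induction k)
    case 0
    then show ?case by simp
  next
    case (Suc k)
    let ?v = "u + int k"
    let ?t = "transpose ?v (?v + 1)"
    show ?case
    \<comment> \<open>For \<open>k = 0\<close> the conjugation identity fails: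
      \<open>transpose u u\<close> is the identity, and the two neighbour transpositions would
      cancel.\<close>
    proof (cases "k = 0")
      case True
      then show ?thesis by (simp add: variation_nonneg)
    next
      case False
      have eq: "transpose u (u + int (Suc k)) = ?t \<circ> (transpose u ?v \<circ> ?t)"
        using False by (auto simp: fun_eq_iff transpose_def)
      have t: "?t permutes {u..u + int d}" "transpose u ?v permutes {u..u + int d}"
        using Suc.prems by (auto intro!: permutes_swap_id)
      have "sqrt (variation f (transpose u (u + int (Suc k))))
          \<le> sqrt (variation f ?t) + (sqrt (variation f (transpose u ?v)) + sqrt (variation f ?t))"
        unfolding eq using variation_sqrt_triangle[OF t(1), of f "transpose u ?v \<circ> ?t"]
          variation_sqrt_triangle[OF t(2), of f "?t"] by linarith
      then show ?thesis using Suc by simp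
    qed
  qed
  from this[of d] have "sqrt (variation f (transpose u (u + int d)))
      \<le> 2 * (\<Sum>j<d. sqrt (variation f (transpose (u + int j) (u + int j + 1))))" by simp
  then have "(sqrt (variation f (transpose u (u + int d))))\<^sup>2
      \<le> (2 * (\<Sum>j<d. sqrt (variation f (transpose (u + int j) (u + int j + 1)))))\<^sup>2"
    by (rule power_mono) (simp add: variation_nonneg)
  also have "\<dots> = 4 * (\<Sum>j<d. sqrt (variation f (transpose (u + int j) (u + int j + 1))))\<^sup>2"
    by (simp add: power2_eq_square)
  also have "\<dots> \<le> 4 * ((\<Sum>j<d. (sqrt (variation f (transpose (u + int j) (u + int j + 1))))\<^sup>2) * card {..<d})"
    by (intro mult_left_mono sum_squared_le_sum_of_squares) simp
  finally show ?thesis by (simp add: variation_nonneg mult_ac)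
qed

text \<open>Equal counts mean equal multisets of truth values, and these differ by a permutation.
  This is the transitivity that makes full averages constant on classes, for filled subsites and for
  occupied sites alike.\<close>

lemma permutes_of_card_eq:
  fixes P Q :: "'a \<Rightarrow> bool"
  assumes A: "finite A" and card: "card {a\<in>A. P a} = card {a\<in>A. Q a}"
  obtains p where "p permutes A" "\<And>a. a \<in> A \<Longrightarrow> Q a = P (p a)"
proof -
  have cnt: "count (image_mset f (mset_set A)) v = card {a\<in>A. f a = v}" for f :: "'a \<Rightarrow> bool" and v
    using A by (auto simp: count_image_mset' Int_def vimage_def conj_commute
        sum.inter_filter[symmetric] intro!: arg_cong[of _ _ card])
  have compl: "card {a\<in>A. f a = False} = card A - card {a\<in>A. f a}" for f :: "'a \<Rightarrow> bool"
  proof -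
    have "{a\<in>A. f a = False} = A - {a\<in>A. f a}" by auto
    then show ?thesis using A by (simp add: card_Diff_subset)
  qed
  have "image_mset Q (mset_set A) = image_mset P (mset_set A)"
  proof (rule multiset_eqI)
    fix v show "count (image_mset Q (mset_set A)) v = count (image_mset P (mset_set A)) v"
      unfolding cnt using card compl[of P] compl[of Q] by (cases v) simp_all
  qed
  from image_mset_eq_implies_permutes[OF A this] obtain p
    where "p permutes A" "\<forall>a\<in>A. Q a = P (p a)" by metis
  then show ?thesis by (intro that[of p]) auto
qed

lemma card_filter_permutes:
  assumes "p permutes A"
  shows "card {a\<in>A. P (p a)} = card {a\<in>A. P a}"
proof -
  have "bij_betw p {a\<in>A. P (p a)} {a\<in>A. P a}"
  proof (rule bij_betwI')
    show "p x = p y \<longleftrightarrow> x = y" for x y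
      using permutes_inj[OF assms] by (auto dest: injD)
    show "p x \<in> {a\<in>A. P a}" if "x \<in> {a\<in>A. P (p a)}" for x
      using that permutes_in_image[OF assms] by auto
    show "\<exists>x\<in>{a\<in>A. P (p a)}. y = p x" if "y \<in> {a\<in>A. P a}" for y
      using that permutes_in_image[OF permutes_inv[OF assms]]
      by (intro bexI[of _ "inv p y"]) (auto simp: permutes_inverses[OF assms])
  qed
  then show ?thesis by (rule bij_betw_same_card)
qed

section \<open>Configurations and subsites\<close>

text \<open>Here \<open>m\<close> stands for \<open>\<kappa> - 1\<close>, and \<open>\<phi>\<close> is the part of the weight of a configuration
  which depends only on the two conserved quantities.\<close>
locale energy_chain =
  fixes m :: nat and I :: "int set" and \<phi> :: "nat \<Rightarrow> nat \<Rightarrow> real"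
  assumes m_pos: "0 < m" and finite_I: "finite I" and phi_nonneg: "0 \<le> \<phi> N E"
begin

text \<open>Local configurations are extended by 0 outside \<open>I\<close>: they keep the type
  \<open>config\<close>, and there are finitely many of them.\<close>

definition X :: "config set" where
  "X = {\<eta>. \<forall>x. (x \<in> I \<longrightarrow> \<eta> x \<in> {0..Suc m}) \<and> (x \<notin> I \<longrightarrow> \<eta> x = 0)}"

definition supp :: "config \<Rightarrow> int set" where
  "supp \<eta> = {x. 0 < \<eta> x}"

definition energy :: "config \<Rightarrow> nat" where
  "energy \<eta> = (\<Sum>x\<in>I. \<eta> x)"

text \<open>The number of ways to choose, at every occupied site, which \<open>\<eta> x - 1\<close>
  of its \<open>m\<close> subsites are filled.\<close>

definition mult :: "config \<Rightarrow> real" where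
  "mult \<eta> = (\<Prod>x\<in>I. if \<eta> x = 0 then 1 else real (m choose (\<eta> x - 1)))"

definition W :: "config \<Rightarrow> real" where
  "W \<eta> = \<phi> (card (supp \<eta>)) (energy \<eta>) * mult \<eta>"

lemma finite_X: "finite X"
  unfolding X_def using finite_I by (rule finite_set_of_finite_funs) simp

lemma X_I: "\<eta> \<in> X \<Longrightarrow> \<eta> x \<le> Suc m"
  unfolding X_def by (cases "x \<in> I") (auto dest: spec[of _ x])

lemma supp_subset: "\<eta> \<in> X \<Longrightarrow> supp \<eta> \<subseteq> I"
  unfolding X_def supp_def by force

lemma finite_supp: "\<eta> \<in> X \<Longrightarrow> finite (supp \<eta>)"
  using supp_subset finite_I finite_subset by blast

lemma mult_pos:
  assumes "\<eta> \<in> X" shows "0 < mult \<eta>"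
  unfolding mult_def
proof (intro prod_pos)
  fix x show "0 < (if \<eta> x = 0 then 1 else real (m choose (\<eta> x - 1)))"
    using X_I[OF assms, of x] by (auto simp: zero_less_binomial_iff)
qed

lemma W_nonneg: "\<eta> \<in> X \<Longrightarrow> 0 \<le> W \<eta>"
  unfolding W_def using mult_pos[of \<eta>] phi_nonneg by simp

lemma X_comp: "p permutes I \<Longrightarrow> \<eta> \<in> X \<Longrightarrow> \<eta> \<circ> p \<in> X"
  unfolding X_def using permutes_in_image[of p I] by (auto simp: permutes_not_in)

lemma card_supp_comp: 
  assumes "p permutes I" "\<eta> \<in> X"
  shows "card (supp (\<eta> \<circ> p)) = card (supp \<eta>)"
proof -
  have "{a \<in> I. 0 < \<eta> a} = supp \<eta>" "{a \<in> I. 0 < \<eta> (p a)} = supp (\<eta> \<circ> p)"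
    using supp_subset[OF assms(2)] supp_subset[OF X_comp[OF assms]] by (auto simp: supp_def)
  then show ?thesis using card_filter_permutes[OF assms(1), of "\<lambda>a. 0 < \<eta> a"] by simp
qed

lemma energy_comp: "p permutes I \<Longrightarrow> energy (\<eta> \<circ> p) = energy \<eta>"
  unfolding energy_def using sum.permute[of p I \<eta>] by simp

lemma mult_comp: "p permutes I \<Longrightarrow> mult (\<eta> \<circ> p) = mult \<eta>"
  unfolding mult_def
  by (subst (2) prod.permute[of p I]) (simp_all add: o_def cong: if_cong)

sublocale sites: perm_weight I X W
  by unfold_locales
    (auto simp: finite_I finite_X W_nonneg X_comp card_supp_comp energy_comp mult_comp,
     simp add: W_def card_supp_comp energy_comp mult_comp)

text \<open>The subsites of \<open>x\<close> are the \<open>m\<close> integers \<open>a\<close> with \<open>a div m = x\<close>.\<close>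
definition subsites :: "int set \<Rightarrow> int set" where
  "subsites S = {a. a div int m \<in> S}"

definition occupations :: "int set \<Rightarrow> (int \<Rightarrow> bool) set" where
  "occupations S = {\<omega>. \<forall>a. \<omega> a \<longrightarrow> a \<in> subsites S}"

definition cfg :: "int set \<Rightarrow> (int \<Rightarrow> bool) \<Rightarrow> config" where
  "cfg S \<omega> x = (if x \<in> S then 1 + card {a\<in>subsites {x}. \<omega> a} else 0)"

lemma subsites_single: "subsites {x} = {x * int m..<x * int m + int m}"
proof -
  have m': "0 < int m" using m_pos by simp
  have "a div int m = x \<longleftrightarrow> x * int m \<le> a \<and> a < x * int m + int m" for a
  proof
    assume [symmetric, simp]: "a div int m = x"
    show "x * int m \<le> a \<and> a < x * int m + int m"
      using pos_mod_bound[OF m', of a] pos_mod_sign[OF m', of a]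
        minus_mod_eq_div_mult[of a "int m", symmetric] by simp
  next
    assume "x * int m \<le> a \<and> a < x * int m + int m"
    then show "a div int m = x"
      using m_pos by (intro int_div_pos_eq[of _ _ _ "a - x * int m"]) (auto simp: mult.commute)
  qed
  then show ?thesis unfolding subsites_def set_eq_iff by simp
qed

lemma finite_subsites_single [simp]: "finite (subsites {x})" and card_subsites_single: "card (subsites {x}) = m"
  by (simp_all add: subsites_single)

lemma subsites_UN: "subsites S = (\<Union>x\<in>S. subsites {x})"
  by (auto simp: subsites_def)

lemma finite_subsites [simp]: "finite S \<Longrightarrow> finite (subsites S)"
  using subsites_UN[of S] by simp

lemma subsites_mono: "T \<subseteq> S \<Longrightarrow> subsites T \<subseteq> subsites S"
  by (auto simp: subsites_def)

lemma subsites_disjoint: "x \<noteq> y \<Longrightarrow> subsites {x} \<inter> subsites {y} = {}"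
  by (auto simp: subsites_def)

lemma sum_subsites:
  assumes "finite S"
  shows "(\<Sum>a\<in>subsites S. g a) = (\<Sum>x\<in>S. \<Sum>a\<in>subsites {x}. g a)"
proof -
  have "(\<Sum>a\<in>(\<Union>x\<in>S. subsites {x}). g a) = (\<Sum>x\<in>S. \<Sum>a\<in>subsites {x}. g a)"
    using assms by (rule sum.UNION_disjoint) (auto dest: subsites_disjoint)
  then show ?thesis by (simp flip: subsites_UN)
qed

lemma finite_occupations:
  assumes "finite S" shows "finite (occupations S)"
proof -
  have "occupations S = {\<omega>. \<forall>a. (a \<in> subsites S \<longrightarrow> \<omega> a \<in> UNIV) \<and> (a \<notin> subsites S \<longrightarrow> \<omega> a = False)}"
    unfolding occupations_def by blast
  then show ?thesis
    using finite_set_of_finite_funs[OF finite_subsites[OF assms] finite[of UNIV], of False] by simp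
qed

lemma cfg_X:
  assumes "S \<subseteq> I" shows "cfg S \<omega> \<in> X"
proof -
  have "card {a\<in>subsites {x}. \<omega> a} \<le> m" for x
  proof -
    have "card {a\<in>subsites {x}. \<omega> a} \<le> card (subsites {x})" by (rule card_mono) auto
    then show ?thesis by (simp add: card_subsites_single)
  qed
  then show ?thesis using assms unfolding X_def cfg_def by auto
qed

lemma supp_cfg [simp]: "supp (cfg S \<omega>) = S"
  by (auto simp: supp_def cfg_def)

lemma energy_cfg:
  assumes "S \<subseteq> I"
  shows "energy (cfg S \<omega>) = card S + card {a\<in>subsites S. \<omega> a}"
proof -
  have fS: "finite S" by (rule finite_subset[OF _ finite_I]) fact
  have "{a\<in>subsites S. \<omega> a} = (\<Union>x\<in>S. {a\<in>subsites {x}. \<omega> a})" by (auto simp: subsites_def)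
  also have "card \<dots> = (\<Sum>x\<in>S. card {a\<in>subsites {x}. \<omega> a})"
  proof (intro card_UN_disjoint fS ballI impI)
    show "finite {a\<in>subsites {x}. \<omega> a}" for x using finite_subsites_single[of x] by simp
  qed (auto simp: subsites_def)
  finally have c: "card {a\<in>subsites S. \<omega> a} = (\<Sum>x\<in>S. card {a\<in>subsites {x}. \<omega> a})" .
  have "energy (cfg S \<omega>) = (\<Sum>x\<in>S. cfg S \<omega> x)"
    unfolding energy_def using assms finite_I by (intro sum.mono_neutral_right) (auto simp: cfg_def)
  also have "\<dots> = (\<Sum>x\<in>S. 1 + card {a\<in>subsites {x}. \<omega> a})" by (intro sum.cong) (auto simp: cfg_def)
  also have "\<dots> = card S + card {a\<in>subsites S. \<omega> a}" by (simp only: sum.distrib c) simp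
  finally show ?thesis .
qed

text \<open>An occupation above \<open>\<eta>\<close> is an independent choice, for each site of
  \<open>S\<close>, of \<open>\<eta> x - 1\<close> subsites among \<open>m\<close>.\<close>

lemma card_fiber:
  assumes S: "S \<subseteq> I" and \<eta>: "\<eta> \<in> X" "supp \<eta> = S"
  shows "real (card {\<omega>\<in>occupations S. cfg S \<omega> = \<eta>}) = mult \<eta>"
proof -
  have fS: "finite S" by (rule finite_subset[OF _ finite_I]) fact
  let ?B = "\<lambda>x. {A. A \<subseteq> subsites {x} \<and> card A = \<eta> x - 1}"
  have pos: "0 < \<eta> x \<longleftrightarrow> x \<in> S" for x using \<eta> by (auto simp: supp_def)
  have "bij_betw (\<lambda>\<omega>. \<lambda>x\<in>S. {a\<in>subsites {x}. \<omega> a}) {\<omega>\<in>occupations S. cfg S \<omega> = \<eta>} (PiE S ?B)"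
  proof (rule bij_betwI[where g = "\<lambda>T a. a div int m \<in> S \<and> a \<in> T (a div int m)"])
    show "(\<lambda>\<omega>. \<lambda>x\<in>S. {a\<in>subsites {x}. \<omega> a}) \<in> {\<omega>\<in>occupations S. cfg S \<omega> = \<eta>} \<rightarrow> PiE S ?B"
      by (auto simp: cfg_def)
  next
    show "(\<lambda>T a. a div int m \<in> S \<and> a \<in> T (a div int m)) \<in> PiE S ?B \<rightarrow> {\<omega>\<in>occupations S. cfg S \<omega> = \<eta>}"
    proof (intro funcsetI CollectI conjI)
      fix T assume T: "T \<in> PiE S ?B"
      show "(\<lambda>a. a div int m \<in> S \<and> a \<in> T (a div int m)) \<in> occupations S"
        by (auto simp: occupations_def subsites_def)
      show "cfg S (\<lambda>a. a div int m \<in> S \<and> a \<in> T (a div int m)) = \<eta>"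
      proof
        fix x
        show "cfg S (\<lambda>a. a div int m \<in> S \<and> a \<in> T (a div int m)) x = \<eta> x"
        proof (cases "x \<in> S")
          case True
          then have "T x \<subseteq> subsites {x}" "card (T x) = \<eta> x - 1" using T by (auto simp: PiE_def Pi_def)
          moreover have "{a \<in> subsites {x}. a div int m \<in> S \<and> a \<in> T (a div int m)} = {a\<in>subsites {x}. a \<in> T x}"
            using True by (auto simp: subsites_def)
          moreover have "{a\<in>subsites {x}. a \<in> T x} = T x" using \<open>T x \<subseteq> subsites {x}\<close> by auto
          ultimately show ?thesis using True pos[of x] by (simp add: cfg_def)
        qed (use pos[of x] in \<open>auto simp: cfg_def\<close>)
      qed
    qed
  next
    fix \<omega> assume "\<omega> \<in> {\<omega>\<in>occupations S. cfg S \<omega> = \<eta>}"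
    then show "(\<lambda>a. a div int m \<in> S \<and> a \<in> (\<lambda>x\<in>S. {a\<in>subsites {x}. \<omega> a}) (a div int m)) = \<omega>"
      by (auto simp: occupations_def subsites_def fun_eq_iff)
  next
    fix T assume T: "T \<in> PiE S ?B"
    show "(\<lambda>x\<in>S. {a \<in> subsites {x}. a div int m \<in> S \<and> a \<in> T (a div int m)}) = T"
    proof
      fix x show "(\<lambda>x\<in>S. {a \<in> subsites {x}. a div int m \<in> S \<and> a \<in> T (a div int m)}) x = T x"
        using T by (cases "x \<in> S") (auto simp: PiE_def Pi_def subsites_def extensional_def)
    qed
  qed
  then have "card {\<omega>\<in>occupations S. cfg S \<omega> = \<eta>} = (\<Prod>x\<in>S. m choose (\<eta> x - 1))"
    using fS by (simp add: bij_betw_same_card card_PiE n_subsets card_subsites_single)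
  moreover have "mult \<eta> = (\<Prod>x\<in>S. real (m choose (\<eta> x - 1)))"
    unfolding mult_def using S finite_I pos
    by (intro prod.mono_neutral_cong_right) auto
  ultimately show ?thesis by simp
qed

lemma lift_sum:
  assumes S: "S \<subseteq> I"
  shows "(\<Sum>\<omega>\<in>occupations S. h (cfg S \<omega>)) = (\<Sum>\<eta>\<in>{\<eta>\<in>X. supp \<eta> = S}. mult \<eta> * h \<eta>)"
proof -
  have fS: "finite S" by (rule finite_subset[OF _ finite_I]) fact
  have "(\<Sum>\<omega>\<in>occupations S. h (cfg S \<omega>))
      = (\<Sum>\<eta>\<in>{\<eta>\<in>X. supp \<eta> = S}. \<Sum>\<omega>\<in>{\<omega>\<in>occupations S. cfg S \<omega> = \<eta>}. h (cfg S \<omega>))"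
    using finite_occupations[OF fS] finite_X cfg_X[OF S]
    by (intro sum.group[symmetric]) auto
  also have "\<dots> = (\<Sum>\<eta>\<in>{\<eta>\<in>X. supp \<eta> = S}. \<Sum>\<omega>\<in>{\<omega>\<in>occupations S. cfg S \<omega> = \<eta>}. h \<eta>)"
    by (intro sum.cong refl) auto
  also have "\<dots> = (\<Sum>\<eta>\<in>{\<eta>\<in>X. supp \<eta> = S}. mult \<eta> * h \<eta>)"
    by (intro sum.cong refl) (use card_fiber[OF S] in auto)
  finally show ?thesis .
qed

text \<open>The factor \<open>mult\<close> of \<open>W\<close> has become the size of the fibre.
  What remains depends on conserved quantities only, hence is invariant under all permutations of
  the subsites of \<open>S\<close>.\<close>

definition lift_weight :: "int set \<Rightarrow> (int \<Rightarrow> bool) \<Rightarrow> real" where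
  "lift_weight S \<omega> = \<phi> (card S) (energy (cfg S \<omega>))"

lemma lift_sum_W:
  assumes S: "S \<subseteq> I"
  shows "(\<Sum>\<omega>\<in>occupations S. lift_weight S \<omega> * h (cfg S \<omega>)) = (\<Sum>\<eta>\<in>{\<eta>\<in>X. supp \<eta> = S}. W \<eta> * h \<eta>)"
  using lift_sum[OF S, of "\<lambda>\<eta>. \<phi> (card S) (energy \<eta>) * h \<eta>"]
  by (auto simp: lift_weight_def W_def mult_ac intro!: sum.cong)

lemma sum_X_supp:
  "(\<Sum>\<eta>\<in>X. g \<eta>) = (\<Sum>S\<in>Pow I. \<Sum>\<eta>\<in>{\<eta>\<in>X. supp \<eta> = S}. g \<eta>)"
  using finite_X finite_I supp_subset by (intro sum.group[symmetric]) auto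

lemma occupations_comp:
  assumes "p permutes subsites S" "\<omega> \<in> occupations S"
  shows "\<omega> \<circ> p \<in> occupations S"
  unfolding occupations_def
proof (intro CollectI allI impI)
  fix a assume "(\<omega> \<circ> p) a"
  then have "p a \<in> subsites S" using assms(2) by (auto simp: occupations_def)
  then show "a \<in> subsites S" using permutes_in_image[OF assms(1)] by simp
qed

lemma energy_cfg_comp:
  assumes "S \<subseteq> I" "p permutes subsites S"
  shows "energy (cfg S (\<omega> \<circ> p)) = energy (cfg S \<omega>)"
  using card_filter_permutes[OF assms(2), of \<omega>] by (simp add: energy_cfg[OF assms(1)])

lemma lift_perm_weight:
  assumes "S \<subseteq> I"
  shows "perm_weight (subsites S) (occupations S) (lift_weight S)"
proof -
  have fS: "finite S" by (rule finite_subset[OF _ finite_I]) fact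
  show ?thesis
    by unfold_locales
      (use fS assms in \<open>auto simp: finite_occupations occupations_comp lift_weight_def phi_nonneg energy_cfg_comp\<close>)
qed

section \<open>Mean-field inequalities\<close>

definition exchange :: "(config \<Rightarrow> real) \<Rightarrow> int \<Rightarrow> int \<Rightarrow> config \<Rightarrow> real" where
  "exchange f x y \<eta> = rate_e (Suc m) \<eta> x y * (f (move_config \<eta> x y) - f \<eta>)\<^sup>2"

lemma rate_e_nonneg: "\<eta> \<in> X \<Longrightarrow> 0 \<le> rate_e (Suc m) \<eta> x y"
  unfolding rate_e_def using X_I[of \<eta> y] by (auto simp: occ_def intro!: mult_nonneg_nonneg)

lemma exchange_nonneg: "\<eta> \<in> X \<Longrightarrow> 0 \<le> exchange f x y \<eta>"
  by (simp add: exchange_def rate_e_nonneg)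

lemma rate_e_eq_0: "x \<notin> supp \<eta> \<or> y \<notin> supp \<eta> \<Longrightarrow> rate_e (Suc m) \<eta> x y = 0"
  by (auto simp: rate_e_def occ_def supp_def)

lemma exchange_eq_0: "x \<notin> supp \<eta> \<or> y \<notin> supp \<eta> \<Longrightarrow> exchange f x y \<eta> = 0"
  by (auto simp: exchange_def rate_e_eq_0)

lemma cfg_transpose_same:
  assumes "a \<in> subsites {x}" "b \<in> subsites {x}"
  shows "cfg S (\<omega> \<circ> transpose a b) = cfg S \<omega>"
proof
  fix y
  have "card {c\<in>subsites {y}. \<omega> (transpose a b c)} = card {c\<in>subsites {y}. \<omega> c}"
  proof (cases "y = x")
    case True
    then show ?thesis using assms card_filter_permutes[OF permutes_swap_id, of a "subsites {x}" b \<omega>] by simp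
  next
    case False
    then have "{c\<in>subsites {y}. \<omega> (transpose a b c)} = {c\<in>subsites {y}. \<omega> c}"
      using assms by (auto simp: transpose_def subsites_def)
    then show ?thesis by simp
  qed
  then show "cfg S (\<omega> \<circ> transpose a b) y = cfg S \<omega> y" by (simp add: cfg_def)
qed

lemma cfg_transpose_move:
  assumes xy: "x \<noteq> y" "x \<in> S" "y \<in> S" and ab: "a \<in> subsites {x}" "b \<in> subsites {y}" "\<omega> a" "\<not> \<omega> b"
  shows "cfg S (\<omega> \<circ> transpose b a) = move_config (cfg S \<omega>) x y"
proof
  fix z
  have fin: "finite {c\<in>subsites {z}. \<omega> c}" for z using finite_subsites_single[of z] by simp
  consider "z = x" | "z = y" | "z \<noteq> x" "z \<noteq> y" by blast
  then show "cfg S (\<omega> \<circ> transpose b a) z = move_config (cfg S \<omega>) x y z"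
  proof cases
    case 1
    have "{c\<in>subsites {x}. \<omega> (transpose b a c)} = {c\<in>subsites {x}. \<omega> c} - {a}"
      using xy ab by (auto simp: transpose_def subsites_def split: if_splits)
    moreover have "a \<in> {c\<in>subsites {x}. \<omega> c}" using ab by simp
    then have "0 < card {c\<in>subsites {x}. \<omega> c}" using fin[of x] card_gt_0_iff by blast
    ultimately show ?thesis using 1 xy ab fin[of x]
      by (simp add: cfg_def move_config_def)
  next
    case 2
    have "{c\<in>subsites {y}. \<omega> (transpose b a c)} = insert b {c\<in>subsites {y}. \<omega> c}"
      using xy ab by (auto simp: transpose_def subsites_def split: if_splits)
    then show ?thesis using 2 xy ab fin[of y]
      by (simp add: cfg_def move_config_def)
  next
    case 3
    have "{c\<in>subsites {z}. \<omega> (transpose b a c)} = {c\<in>subsites {z}. \<omega> c}"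
      using 3 ab by (auto simp: transpose_def subsites_def)
    then show ?thesis using 3 by (simp add: cfg_def move_config_def)
  qed
qed

text \<open>The energy rate is the number of pairs of a filled subsite of \<open>x\<close> and an
  empty subsite of \<open>y\<close>, that is, of the subsite transpositions that carry one unit from
  \<open>x\<close> to \<open>y\<close>.\<close>

lemma rate_e_cfg:
  assumes "x \<in> S" "y \<in> S"
  shows "rate_e (Suc m) (cfg S \<omega>) x y
    = (\<Sum>b\<in>subsites {y}. \<Sum>a\<in>subsites {x}. of_bool (\<omega> a \<and> \<not> \<omega> b))"
proof -
  have c: "real (card {c\<in>subsites {z}. P c}) = (\<Sum>c\<in>subsites {z}. of_bool (P c))" for z P
    by (simp add: sum_of_bool_eq Int_def conj_commute)
  have "(\<Sum>b\<in>subsites {y}. \<Sum>a\<in>subsites {x}. of_bool (\<omega> a \<and> \<not> \<omega> b))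
     = (\<Sum>b\<in>subsites {y}. of_bool (\<not> \<omega> b)) * (\<Sum>a\<in>subsites {x}. of_bool (\<omega> a) :: real)"
    by (simp add: of_bool_conj sum_distrib_left sum_distrib_right mult.commute)
  moreover have "(\<Sum>b\<in>subsites {y}. of_bool (\<not> \<omega> b)) = real m - real (card {b\<in>subsites {y}. \<omega> b})"
    unfolding c by (simp add: of_bool_not_iff sum_subtractf card_subsites_single)
  ultimately show ?thesis using assms
    by (simp add: rate_e_def occ_def cfg_def c)
qed

text \<open>A transposition between the two blocks acts only if exactly one of its subsites is
  filled. The two cases have equal sums by invariance, whence the factor 2, and the pairs in one
  case are counted by \<open>rate_e_cfg\<close>.\<close>

lemma block_variation:
  assumes S: "S \<subseteq> I" and xy: "x \<noteq> y" "x \<in> S" "y \<in> S"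
  shows "(\<Sum>b\<in>subsites {y}. \<Sum>a\<in>subsites {x}. perm_weight.variation (occupations S) (lift_weight S) (\<lambda>\<omega>. f (cfg S \<omega>)) (transpose b a))
    = 2 * (\<Sum>\<eta>\<in>{\<eta>\<in>X. supp \<eta> = S}. W \<eta> * exchange f x y \<eta>)"
proof -
  interpret L: perm_weight "subsites S" "occupations S" "lift_weight S" using S by (rule lift_perm_weight)
  let ?F = "\<lambda>\<omega>. f (cfg S \<omega>)"
  let ?G = "\<lambda>\<omega>. (f (move_config (cfg S \<omega>) x y) - f (cfg S \<omega>))\<^sup>2"
  have 1: "L.variation ?F (transpose b a) = 2 * (\<Sum>\<omega>\<in>occupations S. lift_weight S \<omega> * (of_bool (\<omega> a \<and> \<not> \<omega> b) * ?G \<omega>))"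
    if ab: "a \<in> subsites {x}" "b \<in> subsites {y}" for a b
  proof -
    let ?t = "transpose b a"
    let ?D = "\<lambda>\<omega>. (?F \<omega> - ?F (\<omega> \<circ> ?t))\<^sup>2"
    have t: "?t permutes subsites S" using ab xy by (intro permutes_swap_id) (auto simp: subsites_def)
    have pt: "lift_weight S \<omega> * ?D \<omega> = lift_weight S \<omega> * (of_bool (\<omega> a \<and> \<not> \<omega> b) * ?D \<omega>) + lift_weight S \<omega> * (of_bool (\<omega> b \<and> \<not> \<omega> a) * ?D \<omega>)"
      for \<omega>
    proof (cases "\<omega> a = \<omega> b")
      case True
      then have "\<omega> \<circ> ?t = \<omega>" by (auto simp: fun_eq_iff transpose_def)
      then show ?thesis by (simp only: diff_self) simp
    qed auto
    have "(\<Sum>\<omega>\<in>occupations S. lift_weight S \<omega> * (of_bool (\<omega> b \<and> \<not> \<omega> a) * ?D \<omega>))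
        = (\<Sum>\<omega>\<in>occupations S. lift_weight S \<omega> * (of_bool (\<omega> a \<and> \<not> \<omega> b) * ?D \<omega>))"
      using L.sum_comp_perm[OF t, of "\<lambda>\<omega>. of_bool (\<omega> a \<and> \<not> \<omega> b) * ?D \<omega>"]
      by (simp add: o_assoc[symmetric] power2_commute)
    then have "L.variation ?F ?t = 2 * (\<Sum>\<omega>\<in>occupations S. lift_weight S \<omega> * (of_bool (\<omega> a \<and> \<not> \<omega> b) * ?D \<omega>))"
      unfolding L.variation_def pt sum.distrib by simp
    also have "(\<Sum>\<omega>\<in>occupations S. lift_weight S \<omega> * (of_bool (\<omega> a \<and> \<not> \<omega> b) * ?D \<omega>))
        = (\<Sum>\<omega>\<in>occupations S. lift_weight S \<omega> * (of_bool (\<omega> a \<and> \<not> \<omega> b) * ?G \<omega>))"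
    proof (intro sum.cong refl)
      fix \<omega>
      show "lift_weight S \<omega> * (of_bool (\<omega> a \<and> \<not> \<omega> b) * ?D \<omega>) = lift_weight S \<omega> * (of_bool (\<omega> a \<and> \<not> \<omega> b) * ?G \<omega>)"
        using cfg_transpose_move[OF xy ab, of \<omega>]
        by (cases "\<omega> a \<and> \<not> \<omega> b") (simp_all add: power2_commute)
    qed
    finally show ?thesis .
  qed
  have "(\<Sum>b\<in>subsites {y}. \<Sum>a\<in>subsites {x}. L.variation ?F (transpose b a))
     = (\<Sum>b\<in>subsites {y}. \<Sum>a\<in>subsites {x}. 2 * (\<Sum>\<omega>\<in>occupations S. lift_weight S \<omega> * (of_bool (\<omega> a \<and> \<not> \<omega> b) * ?G \<omega>)))"
    by (intro sum.cong refl 1)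
  also have "\<dots> = 2 * (\<Sum>\<omega>\<in>occupations S. \<Sum>b\<in>subsites {y}. \<Sum>a\<in>subsites {x}. lift_weight S \<omega> * (of_bool (\<omega> a \<and> \<not> \<omega> b) * ?G \<omega>))"
  proof -
    have "(\<Sum>\<omega>\<in>occupations S. \<Sum>b\<in>B. \<Sum>a\<in>A. g \<omega> b a) = (\<Sum>b\<in>B. \<Sum>a\<in>A. \<Sum>\<omega>\<in>occupations S. g \<omega> b a)"
      for A B :: "int set" and g :: "(int \<Rightarrow> bool) \<Rightarrow> int \<Rightarrow> int \<Rightarrow> real"
      by (subst sum.swap) (subst (2) sum.swap, rule refl)
    then show ?thesis by (simp only: sum_distrib_left)
  qed
  also have "\<dots> = 2 * (\<Sum>\<omega>\<in>occupations S. lift_weight S \<omega> * exchange f x y (cfg S \<omega>))"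
    unfolding exchange_def rate_e_cfg[OF xy(2,3)]
    by (simp only: sum_distrib_left sum_distrib_right)
  finally show ?thesis by (simp add: lift_sum_W[OF S])
qed

text \<open>The transposition gap on subsites, collected by sites. It is needed with
  \<open>T = S\<close> for the average over all energies, and with a pair \<open>T\<close> for the
  swap of two energies.\<close>

lemma lifted_gap:
  assumes S: "S \<subseteq> I" and T: "T \<subseteq> S"
  shows "(\<Sum>\<omega>\<in>occupations S. lift_weight S \<omega> * (f (cfg S \<omega>))\<^sup>2)
    \<le> (\<Sum>\<omega>\<in>occupations S. lift_weight S \<omega> * (perm_avg (subsites T) (\<lambda>\<omega>. f (cfg S \<omega>)) \<omega>)\<^sup>2)
      + (\<Sum>y\<in>T. \<Sum>x\<in>{x\<in>T. x < y}. (\<Sum>\<eta>\<in>{\<eta>\<in>X. supp \<eta> = S}. W \<eta> * exchange f x y \<eta>) / card {z\<in>T. z \<le> y})"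
proof -
  interpret L: perm_weight "subsites S" "occupations S" "lift_weight S" using S by (rule lift_perm_weight)
  have fT: "finite T" using T S finite_I by (meson finite_subset)
  let ?F = "\<lambda>\<omega>. f (cfg S \<omega>)"
  let ?V = "\<lambda>k i. L.variation ?F (transpose k i)"
  have m': "0 < int m" using m_pos by simp
  have div_less: "k div int m < i div int m \<Longrightarrow> k < i" for k i
    using zdiv_mono1[of i k "int m"] m' by linarith
  have V0: "?V k i = 0" if "k \<in> subsites {y}" "i \<in> subsites {y}" for k i y
    using that by (simp add: L.variation_def cfg_transpose_same)
  \<comment> \<open>Blocks are ordered like their sites: below \<open>k\<close> lie all subsites of
    the sites before \<open>y\<close>, and some of the block of \<open>y\<close> itself, which
    contribute 0 by \<open>V0\<close>.\<close>
  have inner: "(\<Sum>i\<in>{i\<in>subsites T. i < k}. ?V k i) = (\<Sum>x\<in>{x\<in>T. x < y}. \<Sum>i\<in>subsites {x}. ?V k i)"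
    if k: "k \<in> subsites {y}" for k y
  proof -
    have "(\<Sum>i\<in>{i\<in>subsites T. i < k}. ?V k i) = (\<Sum>i\<in>subsites T. if i < k then ?V k i else 0)"
      using fT by (intro sum.inter_filter) simp
    also have "\<dots> = (\<Sum>x\<in>T. \<Sum>i\<in>subsites {x}. if i < k then ?V k i else 0)"
      by (rule sum_subsites) (rule fT)
    also have "\<dots> = (\<Sum>x\<in>T. if x < y then \<Sum>i\<in>subsites {x}. ?V k i else 0)"
    proof (intro sum.cong refl)
      fix x
      consider "x < y" | "x = y" | "y < x" by linarith
      then show "(\<Sum>i\<in>subsites {x}. if i < k then ?V k i else 0) = (if x < y then \<Sum>i\<in>subsites {x}. ?V k i else 0)"
      proof cases
        case 1
        have "i < k" if "i \<in> subsites {x}" for i using that k 1 div_less[of i k] by (simp add: subsites_def)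
        then show ?thesis using 1 by (simp cong: sum.cong)
      next
        case 2
        then show ?thesis using V0[OF k] by (auto intro!: sum.neutral)
      next
        case 3
        have "\<not> i < k" if "i \<in> subsites {x}" for i using that k 3 div_less[of k i] by (simp add: subsites_def)
        then show ?thesis using 3 by (auto intro!: sum.neutral)
      qed
    qed
    also have "\<dots> = (\<Sum>x\<in>{x\<in>T. x < y}. \<Sum>i\<in>subsites {x}. ?V k i)"
      using fT by (intro sum.inter_filter[symmetric])
    finally show ?thesis .
  qed
  \<comment> \<open>Only the first subsite \<open>z * int m\<close> of each site is counted. This
    turns a number of subsites into a number of particles.\<close>
  have cardle: "card {z\<in>T. z \<le> y} \<le> card {i\<in>subsites T. i \<le> k}" if k: "k \<in> subsites {y}" for k y
  proof (rule card_inj_on_le[of "\<lambda>z. z * int m"])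
    show "inj_on (\<lambda>z. z * int m) {z \<in> T. z \<le> y}" using m' by (auto simp: inj_on_def)
    have "y * int m \<le> k" using k by (simp add: subsites_single)
    then have "z * int m \<le> k" if "z \<le> y" for z
      using that m' mult_right_mono[of z y "int m"] by linarith
    then show "(\<lambda>z. z * int m) ` {z \<in> T. z \<le> y} \<subseteq> {i \<in> subsites T. i \<le> k}"
      using m' by (auto simp: subsites_def)
    show "finite {i \<in> subsites T. i \<le> k}" using fT by simp
  qed
  have pos: "0 < card {z\<in>T. z \<le> y}" if "y \<in> T" for y
    using that fT by (auto simp: card_gt_0_iff)
  have "(\<Sum>k\<in>subsites T. (\<Sum>i\<in>{i\<in>subsites T. i < k}. ?V k i) / (2 * card {i\<in>subsites T. i \<le> k}))
      = (\<Sum>y\<in>T. \<Sum>k\<in>subsites {y}. (\<Sum>x\<in>{x\<in>T. x < y}. \<Sum>i\<in>subsites {x}. ?V k i) / (2 * card {i\<in>subsites T. i \<le> k}))"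
    unfolding sum_subsites[OF fT] by (intro sum.cong refl) (simp add: inner)
  also have "\<dots> \<le> (\<Sum>y\<in>T. \<Sum>k\<in>subsites {y}. (\<Sum>x\<in>{x\<in>T. x < y}. \<Sum>i\<in>subsites {x}. ?V k i) / (2 * card {z\<in>T. z \<le> y}))"
    using cardle pos
    by (intro sum_mono divide_left_mono mult_pos_pos sum_nonneg L.variation_nonneg)
       (auto intro: less_le_trans)
  also have "\<dots> = (\<Sum>y\<in>T. \<Sum>x\<in>{x\<in>T. x < y}. (\<Sum>k\<in>subsites {y}. \<Sum>i\<in>subsites {x}. ?V k i) / (2 * card {z\<in>T. z \<le> y}))"
  proof (rule sum.cong[OF refl])
    fix y
    show "(\<Sum>k\<in>subsites {y}. (\<Sum>x\<in>{x\<in>T. x < y}. \<Sum>i\<in>subsites {x}. ?V k i) / (2 * card {z\<in>T. z \<le> y}))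
      = (\<Sum>x\<in>{x\<in>T. x < y}. (\<Sum>k\<in>subsites {y}. \<Sum>i\<in>subsites {x}. ?V k i) / (2 * card {z\<in>T. z \<le> y}))"
      unfolding sum_divide_distrib[symmetric] by (subst sum.swap) (rule refl)
  qed
  also have "\<dots> = (\<Sum>y\<in>T. \<Sum>x\<in>{x\<in>T. x < y}. (\<Sum>\<eta>\<in>{\<eta>\<in>X. supp \<eta> = S}. W \<eta> * exchange f x y \<eta>) / card {z\<in>T. z \<le> y})"
  proof (intro sum.cong refl)
    fix y x assume "y \<in> T" "x \<in> {x\<in>T. x < y}"
    then have "x \<noteq> y" "x \<in> S" "y \<in> S" using T by auto
    from block_variation[OF S this] show "(\<Sum>k\<in>subsites {y}. \<Sum>i\<in>subsites {x}. ?V k i) / (2 * card {z\<in>T. z \<le> y})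
      = (\<Sum>\<eta>\<in>{\<eta>\<in>X. supp \<eta> = S}. W \<eta> * exchange f x y \<eta>) / card {z\<in>T. z \<le> y}" by simp
  qed
  finally show ?thesis
    using transposition_gap[OF L.perm_weight_axioms subsites_mono[OF T], of ?F] by linarith
qed


section \<open>Swapping the energies of two particles\<close>

definition block_swap :: "int \<Rightarrow> int \<Rightarrow> int \<Rightarrow> int" where
  "block_swap x y a = (if a \<in> subsites {x} then a + (y - x) * int m
     else if a \<in> subsites {y} then a - (y - x) * int m else a)"

lemma block_swap_subsites:
  assumes "x \<noteq> y"
  shows "a \<in> subsites {x} \<Longrightarrow> block_swap x y a \<in> subsites {y}" "a \<in> subsites {y} \<Longrightarrow> block_swap x y a \<in> subsites {x}"
  using assms subsites_disjoint[OF assms] by (auto simp: block_swap_def subsites_single algebra_simps)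

lemma block_swap_involution:
  assumes "x \<noteq> y" shows "block_swap x y (block_swap x y a) = a"
proof -
  consider "a \<in> subsites {x}" | "a \<in> subsites {y}" | "a \<notin> subsites {x}" "a \<notin> subsites {y}" by blast
  then show ?thesis
  proof cases
    case 1
    have "block_swap x y a \<in> subsites {y}" "block_swap x y a \<notin> subsites {x}"
      using block_swap_subsites(1)[OF assms 1] subsites_disjoint[OF assms] by auto
    then show ?thesis using 1 by (simp add: block_swap_def)
  next
    case 2
    then have "a \<notin> subsites {x}" using subsites_disjoint[OF assms] by auto
    then show ?thesis using 2 block_swap_subsites(2)[OF assms 2] by (simp add: block_swap_def)
  qed (simp add: block_swap_def)
qed

lemma block_swap_permutes:
  assumes "x \<noteq> y" shows "block_swap x y permutes subsites {x, y}"
  unfolding permutes_def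
proof (intro conjI allI impI)
  fix a assume "a \<notin> subsites {x, y}"
  then show "block_swap x y a = a" by (auto simp: block_swap_def subsites_def)
next
  fix b show "\<exists>!a. block_swap x y a = b"
    using block_swap_involution[OF assms] by metis
qed

lemma cfg_block_swap:
  assumes "x \<noteq> y" "x \<in> S" "y \<in> S"
  shows "cfg S (\<omega> \<circ> block_swap x y) = swap_config (cfg S \<omega>) x y"
proof
  fix z
  have *: "card {c\<in>subsites {u}. \<omega> (block_swap x y c)} = card {c\<in>subsites {v}. \<omega> c}"
    if "\<And>c. c \<in> subsites {u} \<Longrightarrow> block_swap x y c \<in> subsites {v}" "\<And>c. c \<in> subsites {v} \<Longrightarrow> block_swap x y c \<in> subsites {u}" for u v
  proof (rule bij_betw_same_card[of "block_swap x y"])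
    show "bij_betw (block_swap x y) {c\<in>subsites {u}. \<omega> (block_swap x y c)} {c\<in>subsites {v}. \<omega> c}"
      by (rule bij_betwI[where g = "block_swap x y"])
         (use that block_swap_involution[OF assms(1)] in auto)
  qed
  show "cfg S (\<omega> \<circ> block_swap x y) z = swap_config (cfg S \<omega>) x y z"
  proof -
    consider "z = x" | "z = y" | "z \<noteq> x" "z \<noteq> y" by blast
    then show ?thesis
    proof cases
      case 1
      then show ?thesis using assms *[of x y] block_swap_subsites[OF assms(1)]
        by (simp add: cfg_def swap_config_def)
    next
      case 2
      then show ?thesis using assms *[of y x] block_swap_subsites[OF assms(1)]
        by (simp add: cfg_def swap_config_def)
    next
      case 3
      then have "{c\<in>subsites {z}. \<omega> (block_swap x y c)} = {c\<in>subsites {z}. \<omega> c}"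
        by (auto simp: block_swap_def subsites_def)
      then show ?thesis using 3 by (simp add: cfg_def swap_config_def)
    qed
  qed
qed

text \<open>Exchanging the energies of two particles permutes their subsites, so it costs at most four times
  the distance to the average over all such permutations.\<close>
lemma swap_pair:
  assumes S: "S \<subseteq> I" and xy: "x < y" "x \<in> S" "y \<in> S"
  shows "(\<Sum>\<eta>\<in>{\<eta>\<in>X. supp \<eta> = S}. W \<eta> * (f \<eta> - f (swap_config \<eta> x y))\<^sup>2)
    \<le> 2 * (\<Sum>\<eta>\<in>{\<eta>\<in>X. supp \<eta> = S}. W \<eta> * exchange f x y \<eta>)"
proof -
  interpret L: perm_weight "subsites S" "occupations S" "lift_weight S" using S by (rule lift_perm_weight)
  let ?F = "\<lambda>\<omega>. f (cfg S \<omega>)"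
  let ?P = "perm_avg (subsites {x, y}) ?F"
  let ?\<sigma> = "block_swap x y"
  have T: "{x, y} \<subseteq> S" "subsites {x, y} \<subseteq> subsites S" using xy subsites_mono[of "{x, y}" S] by auto
  have \<sigma>: "?\<sigma> permutes subsites {x, y}" "?\<sigma> permutes subsites S"
    using block_swap_permutes[of x y] xy permutes_subset[OF _ T(2)] by auto
  have P\<sigma>: "?P (\<omega> \<circ> ?\<sigma>) = ?P \<omega>" for \<omega> by (rule perm_avg_comp) (rule \<sigma>(1))
  have PP: "(\<Sum>\<omega>\<in>occupations S. lift_weight S \<omega> * (?F \<omega> * ?P \<omega>)) = (\<Sum>\<omega>\<in>occupations S. lift_weight S \<omega> * (?P \<omega> * ?P \<omega>))"
    by (rule L.sum_perm_avg_mult[OF T(2), symmetric]) (rule perm_avg_comp)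
  have "(\<Sum>\<omega>\<in>occupations S. lift_weight S \<omega> * (?F \<omega> - ?P \<omega>)\<^sup>2) = (\<Sum>\<omega>\<in>occupations S. lift_weight S \<omega> * (?F \<omega>)\<^sup>2)
      - 2 * (\<Sum>\<omega>\<in>occupations S. lift_weight S \<omega> * (?F \<omega> * ?P \<omega>)) + (\<Sum>\<omega>\<in>occupations S. lift_weight S \<omega> * (?P \<omega> * ?P \<omega>))"
    unfolding sum_distrib_left sum_subtractf[symmetric] sum.distrib[symmetric]
    by (intro sum.cong refl) (simp add: power2_eq_square algebra_simps)
  then have "(\<Sum>\<omega>\<in>occupations S. lift_weight S \<omega> * (?F \<omega> - ?P \<omega>)\<^sup>2)
      = (\<Sum>\<omega>\<in>occupations S. lift_weight S \<omega> * (?F \<omega>)\<^sup>2) - (\<Sum>\<omega>\<in>occupations S. lift_weight S \<omega> * (?P \<omega>)\<^sup>2)"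
    unfolding PP by (simp add: power2_eq_square)
  \<comment> \<open>For the set \<open>{x, y}\<close> the only pair is \<open>x < y\<close>, with
    two sites up to \<open>y\<close>; this 1/2 turns the factor four into the constant 2 of the
    statement.\<close>
  moreover have "(\<Sum>v\<in>{x, y}. \<Sum>u\<in>{u\<in>{x, y}. u < v}.
        (\<Sum>\<eta>\<in>{\<eta>\<in>X. supp \<eta> = S}. W \<eta> * exchange f u v \<eta>) / card {z\<in>{x, y}. z \<le> v})
      = (\<Sum>\<eta>\<in>{\<eta>\<in>X. supp \<eta> = S}. W \<eta> * exchange f x y \<eta>) / 2"
  proof -
    have "{u\<in>{x, y}. u < x} = {}" "{u\<in>{x, y}. u < y} = {x}" "{z\<in>{x, y}. z \<le> y} = {x, y}"
      using xy by auto
    moreover have "(\<Sum>v\<in>{x, y}. g v) = g x + g y" for g :: "int \<Rightarrow> real" using xy by simp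
    ultimately show ?thesis using xy by (simp only:) simp
  qed
  ultimately have *: "(\<Sum>\<omega>\<in>occupations S. lift_weight S \<omega> * (?F \<omega> - ?P \<omega>)\<^sup>2)
      \<le> (\<Sum>\<eta>\<in>{\<eta>\<in>X. supp \<eta> = S}. W \<eta> * exchange f x y \<eta>) / 2"
    using lifted_gap[OF S T(1), of f] by linarith
  have sq: "(a - b)\<^sup>2 \<le> 2 * (a - c)\<^sup>2 + 2 * (b - c)\<^sup>2" for a b c :: real
    using zero_le_power2[of "(a - c) + (b - c)"] by (simp add: power2_eq_square algebra_simps)
  have "(\<Sum>\<eta>\<in>{\<eta>\<in>X. supp \<eta> = S}. W \<eta> * (f \<eta> - f (swap_config \<eta> x y))\<^sup>2)
      = (\<Sum>\<omega>\<in>occupations S. lift_weight S \<omega> * (?F \<omega> - ?F (\<omega> \<circ> ?\<sigma>))\<^sup>2)"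
    using xy by (simp add: lift_sum_W[OF S, symmetric] cfg_block_swap)
  also have "\<dots> \<le> (\<Sum>\<omega>\<in>occupations S. lift_weight S \<omega> * (2 * (?F \<omega> - ?P \<omega>)\<^sup>2 + 2 * (?F (\<omega> \<circ> ?\<sigma>) - ?P \<omega>)\<^sup>2))"
    by (intro sum_mono mult_left_mono sq L.w_nonneg)
  also have "\<dots> = 2 * (\<Sum>\<omega>\<in>occupations S. lift_weight S \<omega> * (?F \<omega> - ?P \<omega>)\<^sup>2)
      + 2 * (\<Sum>\<omega>\<in>occupations S. lift_weight S \<omega> * (?F (\<omega> \<circ> ?\<sigma>) - ?P (\<omega> \<circ> ?\<sigma>))\<^sup>2)"
    by (simp add: P\<sigma> sum_distrib_left distrib_left sum.distrib mult_ac)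
  also have "\<dots> = 4 * (\<Sum>\<omega>\<in>occupations S. lift_weight S \<omega> * (?F \<omega> - ?P \<omega>)\<^sup>2)"
    using L.sum_comp_perm[OF \<sigma>(2), of "\<lambda>\<omega>. (?F \<omega> - ?P \<omega>)\<^sup>2"] by simp
  finally show ?thesis using * by simp
qed

section \<open>Averaging over energies at fixed positions, then over positions\<close>

definition energy_class :: "config \<Rightarrow> config set" where
  "energy_class \<eta> = {\<zeta>\<in>X. supp \<zeta> = supp \<eta> \<and> energy \<zeta> = energy \<eta>}"

text \<open>Conditional mean given the support and the energy. Since \<open>\<phi>\<close> is
  constant on a class, weighting by \<open>mult\<close> agrees with weighting by \<open>W\<close>
  and still makes sense where \<open>\<phi>\<close> vanishes.\<close>

definition cmean :: "(config \<Rightarrow> real) \<Rightarrow> config \<Rightarrow> real" where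
  "cmean f \<eta> = (\<Sum>\<zeta>\<in>energy_class \<eta>. mult \<zeta> * f \<zeta>) / (\<Sum>\<zeta>\<in>energy_class \<eta>. mult \<zeta>)"

lemma sum_mult_pos:
  assumes "C \<subseteq> X" "\<eta> \<in> C" shows "0 < (\<Sum>\<zeta>\<in>C. mult \<zeta>)"
  using assms finite_subset[OF assms(1) finite_X] mult_pos
  by (intro sum_pos) auto

lemma cmean_cong:
  "supp \<zeta> = supp \<eta> \<Longrightarrow> energy \<zeta> = energy \<eta> \<Longrightarrow> cmean f \<zeta> = cmean f \<eta>"
  by (simp add: cmean_def energy_class_def)

lemma cmean_times_mult:
  assumes "\<eta> \<in> X"
  shows "cmean f \<eta> * (\<Sum>\<zeta>\<in>energy_class \<eta>. mult \<zeta>) = (\<Sum>\<zeta>\<in>energy_class \<eta>. mult \<zeta> * f \<zeta>)"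
  using sum_mult_pos[of "energy_class \<eta>" \<eta>] assms by (auto simp: cmean_def energy_class_def)

lemma supp_comp: "supp (\<eta> \<circ> p) = p -` supp \<eta>"
  by (auto simp: supp_def)

text \<open>A permutation of the sites maps energy classes bijectively onto energy classes and
  preserves \<open>mult\<close>.\<close>

lemma cmean_comp:
  assumes p: "p permutes I" and \<eta>: "\<eta> \<in> X"
  shows "cmean f (\<eta> \<circ> p) = cmean (\<lambda>\<zeta>. f (\<zeta> \<circ> p)) \<eta>"
proof -
  have p': "inv p permutes I" by (rule permutes_inv[OF p])
  have inv: "\<zeta> \<circ> inv p \<circ> p = \<zeta>" "\<zeta> \<circ> p \<circ> inv p = \<zeta>" for \<zeta> :: config
    using permutes_inv_o[OF p] by (simp_all add: o_assoc[symmetric])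
  have energy_class: "\<zeta> \<circ> p \<in> energy_class (\<eta> \<circ> p) \<longleftrightarrow> \<zeta> \<in> energy_class \<eta>" if "\<zeta> \<in> X" for \<zeta>
    using that X_comp[OF p] energy_comp[OF p] permutes_surj[OF p]
    by (auto simp: energy_class_def supp_comp surj_vimage_empty) (metis surj_image_vimage_eq)+
  have "sum h (energy_class (\<eta> \<circ> p)) = (\<Sum>\<zeta>\<in>energy_class \<eta>. h (\<zeta> \<circ> p))" for h :: "config \<Rightarrow> real"
  proof (rule sum.reindex_bij_witness[of _ "\<lambda>\<zeta>. \<zeta> \<circ> p" "\<lambda>\<zeta>. \<zeta> \<circ> inv p"])
    fix \<zeta> assume a: "\<zeta> \<in> energy_class (\<eta> \<circ> p)"
    then have "\<zeta> \<circ> inv p \<in> X" using X_comp[OF p'] by (simp add: energy_class_def)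
    from energy_class[OF this] a show "\<zeta> \<circ> inv p \<in> energy_class \<eta>" by (simp add: inv)
  next
    fix \<zeta> assume "\<zeta> \<in> energy_class \<eta>"
    then show "\<zeta> \<circ> p \<in> energy_class (\<eta> \<circ> p)" using energy_class[of \<zeta>] by (simp add: energy_class_def)
  qed (simp_all add: inv)
  then show ?thesis by (simp add: cmean_def mult_comp[OF p])
qed

text \<open>On each class \<open>W\<close> is a constant multiple of \<open>mult\<close> and
  \<open>g\<close> is constant, so the two sides agree class by class.\<close>

lemma sum_W_cmean:
  assumes g: "\<And>\<eta> \<zeta>. \<eta> \<in> X \<Longrightarrow> \<zeta> \<in> X \<Longrightarrow> supp \<zeta> = supp \<eta> \<Longrightarrow> energy \<zeta> = energy \<eta> \<Longrightarrow> g \<zeta> = g \<eta>"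
  shows "(\<Sum>\<eta>\<in>X. W \<eta> * (cmean f \<eta> * g \<eta>)) = (\<Sum>\<eta>\<in>X. W \<eta> * (f \<eta> * g \<eta>))"
proof -
  let ?key = "\<lambda>\<eta>. (supp \<eta>, energy \<eta>)"
  have grp: "(\<Sum>\<eta>\<in>X. h \<eta>) = (\<Sum>k\<in>?key ` X. \<Sum>\<eta>\<in>{\<eta>\<in>X. ?key \<eta> = k}. h \<eta>)" for h :: "config \<Rightarrow> real"
    using finite_X by (intro sum.group[symmetric]) auto
  show ?thesis unfolding grp
  proof (rule sum.cong[OF refl])
    fix k assume "k \<in> ?key ` X"
    then obtain \<eta> where \<eta>: "\<eta> \<in> X" "k = ?key \<eta>" by auto
    have C: "{\<zeta>\<in>X. ?key \<zeta> = k} = energy_class \<eta>" using \<eta> by (auto simp: energy_class_def)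
    let ?c = "\<phi> (card (supp \<eta>)) (energy \<eta>) * g \<eta>"
    have *: "W \<zeta> = \<phi> (card (supp \<eta>)) (energy \<eta>) * mult \<zeta>" "g \<zeta> = g \<eta>" "cmean f \<zeta> = cmean f \<eta>" if "\<zeta> \<in> energy_class \<eta>" for \<zeta>
      using that g[of \<eta> \<zeta>] \<eta>(1) cmean_cong[of \<zeta> \<eta>] by (auto simp: energy_class_def W_def)
    have "(\<Sum>\<zeta>\<in>energy_class \<eta>. W \<zeta> * (cmean f \<zeta> * g \<zeta>)) = ?c * (cmean f \<eta> * (\<Sum>\<zeta>\<in>energy_class \<eta>. mult \<zeta>))"
      unfolding sum_distrib_left by (intro sum.cong refl) (simp add: *)
    also have "\<dots> = (\<Sum>\<zeta>\<in>energy_class \<eta>. W \<zeta> * (f \<zeta> * g \<zeta>))"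
      unfolding cmean_times_mult[OF \<eta>(1)] unfolding sum_distrib_left by (intro sum.cong refl) (simp add: *)
    finally show "(\<Sum>\<eta>\<in>{\<eta>\<in>X. ?key \<eta> = k}. W \<eta> * (cmean f \<eta> * g \<eta>))
      = (\<Sum>\<eta>\<in>{\<eta>\<in>X. ?key \<eta> = k}. W \<eta> * (f \<eta> * g \<eta>))" unfolding C .
  qed
qed

lemma cmean_contraction: "(\<Sum>\<eta>\<in>X. W \<eta> * (cmean h \<eta>)\<^sup>2) \<le> (\<Sum>\<eta>\<in>X. W \<eta> * (h \<eta>)\<^sup>2)"
proof -
  have "(\<Sum>\<eta>\<in>X. W \<eta> * (cmean h \<eta> * cmean h \<eta>)) = (\<Sum>\<eta>\<in>X. W \<eta> * (h \<eta> * cmean h \<eta>))"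
    by (rule sum_W_cmean) (rule cmean_cong)
  moreover have "0 \<le> (\<Sum>\<eta>\<in>X. W \<eta> * (h \<eta> - cmean h \<eta>)\<^sup>2)"
    by (intro sum_nonneg mult_nonneg_nonneg W_nonneg) auto
  moreover have "(\<Sum>\<eta>\<in>X. W \<eta> * (h \<eta> - cmean h \<eta>)\<^sup>2) = (\<Sum>\<eta>\<in>X. W \<eta> * (h \<eta>)\<^sup>2)
      - 2 * (\<Sum>\<eta>\<in>X. W \<eta> * (h \<eta> * cmean h \<eta>)) + (\<Sum>\<eta>\<in>X. W \<eta> * (cmean h \<eta> * cmean h \<eta>))"
    unfolding sum_distrib_left sum_subtractf[symmetric] sum.distrib[symmetric]
    by (intro sum.cong refl) (simp add: power2_eq_square algebra_simps)
  ultimately show ?thesis by (simp add: power2_eq_square)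
qed

lemma cmean_diff: "cmean (\<lambda>\<eta>. f \<eta> - g \<eta>) \<eta> = cmean f \<eta> - cmean g \<eta>"
  by (simp add: cmean_def right_diff_distrib sum_subtractf diff_divide_distrib)

text \<open>By equivariance, the increment of the conditional mean along \<open>p\<close> is the
  conditional mean of the increment of \<open>f\<close>, and conditional means contract in
  L2.\<close>

lemma variation_cmean_le:
  assumes p: "p permutes I"
  shows "sites.variation (cmean f) p \<le> sites.variation f p"
proof -
  have "sites.variation (cmean f) p = (\<Sum>\<eta>\<in>X. W \<eta> * (cmean (\<lambda>\<eta>. f \<eta> - f (\<eta> \<circ> p)) \<eta>)\<^sup>2)"
    unfolding sites.variation_def by (intro sum.cong refl) (simp add: cmean_diff cmean_comp[OF p])
  also have "\<dots> \<le> sites.variation f p"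
    unfolding sites.variation_def by (rule cmean_contraction)
  finally show ?thesis .
qed

text \<open>Permutations of subsites act transitively on the occupations of given energy, so the
  left-hand side is constant there and equals its own mean; averaging preserves that mean. The
  auxiliary weight \<open>?w\<close> singles out the energy of \<open>\<omega>\<close>.\<close>

lemma perm_avg_cmean:
  assumes S: "S \<subseteq> I" and \<omega>: "\<omega> \<in> occupations S"
  shows "perm_avg (subsites S) (\<lambda>\<omega>. f (cfg S \<omega>)) \<omega> = cmean f (cfg S \<omega>)"
proof -
  have fS: "finite S" by (rule finite_subset[OF _ finite_I]) fact
  let ?F = "\<lambda>\<omega>. f (cfg S \<omega>)"
  let ?w = "\<lambda>\<omega>'. of_bool (energy (cfg S \<omega>') = energy (cfg S \<omega>)) :: real"
  interpret P: perm_weight "subsites S" "occupations S" ?w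
    by unfold_locales (use fS S in \<open>auto simp: finite_occupations occupations_comp energy_cfg_comp\<close>)
  have const: "perm_avg (subsites S) ?F \<omega>' = perm_avg (subsites S) ?F \<omega>"
    if \<omega>': "\<omega>' \<in> occupations S" "energy (cfg S \<omega>') = energy (cfg S \<omega>)" for \<omega>'
  proof -
    have "card {a\<in>subsites S. \<omega> a} = card {a\<in>subsites S. \<omega>' a}"
      using \<omega>'(2) by (simp add: energy_cfg[OF S])
    from permutes_of_card_eq[OF finite_subsites[OF fS] this]
    obtain p where p: "p permutes subsites S" "\<And>a. a \<in> subsites S \<Longrightarrow> \<omega>' a = \<omega> (p a)" by metis
    have "\<omega>' = \<omega> \<circ> p"
    proof
      fix a show "\<omega>' a = (\<omega> \<circ> p) a"
        using p \<omega>'(1) \<omega> by (cases "a \<in> subsites S") (auto simp: occupations_def permutes_not_in)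
    qed
    then show ?thesis by (simp add: perm_avg_comp[OF p(1)])
  qed
  have cl: "(\<Sum>\<omega>'\<in>occupations S. ?w \<omega>' * h (cfg S \<omega>')) = (\<Sum>\<zeta>\<in>energy_class (cfg S \<omega>). mult \<zeta> * h \<zeta>)" for h
  proof -
    have "(\<Sum>\<omega>'\<in>occupations S. ?w \<omega>' * h (cfg S \<omega>'))
        = (\<Sum>\<zeta>\<in>{\<zeta>\<in>X. supp \<zeta> = S}. mult \<zeta> * (of_bool (energy \<zeta> = energy (cfg S \<omega>)) * h \<zeta>))"
      by (rule lift_sum[OF S])
    also have "\<dots> = (\<Sum>\<zeta>\<in>energy_class (cfg S \<omega>). mult \<zeta> * h \<zeta>)"
      using finite_X by (intro sum.mono_neutral_cong_right) (auto simp: energy_class_def)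
    finally show ?thesis .
  qed
  have "perm_avg (subsites S) ?F \<omega> * (\<Sum>\<omega>'\<in>occupations S. ?w \<omega>') = (\<Sum>\<omega>'\<in>occupations S. ?w \<omega>' * perm_avg (subsites S) ?F \<omega>')"
    unfolding sum_distrib_left by (intro sum.cong refl) (auto simp: const)
  also have "\<dots> = (\<Sum>\<zeta>\<in>energy_class (cfg S \<omega>). mult \<zeta> * f \<zeta>)"
    unfolding cl[symmetric] by (rule P.sum_perm_avg) simp
  finally have "perm_avg (subsites S) ?F \<omega> * (\<Sum>\<zeta>\<in>energy_class (cfg S \<omega>). mult \<zeta>) = (\<Sum>\<zeta>\<in>energy_class (cfg S \<omega>). mult \<zeta> * f \<zeta>)"
    using cl[of "\<lambda>_. 1"] by simp
  moreover have "0 < (\<Sum>\<zeta>\<in>energy_class (cfg S \<omega>). mult \<zeta>)"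
    using cfg_X[OF S] by (intro sum_mult_pos[of _ "cfg S \<omega>"]) (auto simp: energy_class_def)
  ultimately show ?thesis by (simp add: cmean_def field_simps)
qed

text \<open>Permutations of sites act transitively on supports of given size, and
  \<open>cmean f\<close> sees only support and energy. Its symmetrisation is thus constant on a
  class of given particle number and energy, where its mean is that of \<open>f\<close>, namely
  0.\<close>

lemma perm_avg_cmean_eq_0:
  assumes zero: "\<And>N E. (\<Sum>\<eta>\<in>{\<eta>\<in>X. card (supp \<eta>) = N \<and> energy \<eta> = E}. mult \<eta> * f \<eta>) = 0"
    and \<eta>: "\<eta> \<in> X"
  shows "perm_avg I (cmean f) \<eta> = 0"
proof -
  let ?N = "card (supp \<eta>)" and ?E = "energy \<eta>"
  \<comment> \<open>The same chain with \<open>\<phi>\<close> the indicator of one pair of conserved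
    quantities, so that the averaging identities speak of a single class.\<close>
  interpret ind: energy_chain m I "\<lambda>N E. of_bool (N = ?N \<and> E = ?E)"
    by unfold_locales (auto simp: m_pos finite_I)
  have const: "perm_avg I (cmean f) \<zeta> = perm_avg I (cmean f) \<eta>"
    if \<zeta>: "\<zeta> \<in> X" "card (supp \<zeta>) = ?N" "energy \<zeta> = ?E" for \<zeta>
  proof -
    have "{a\<in>I. 0 < \<eta> a} = supp \<eta>" "{a\<in>I. 0 < \<zeta> a} = supp \<zeta>"
      using supp_subset[OF \<eta>] supp_subset[OF \<zeta>(1)] by (auto simp: supp_def)
    then have "card {a\<in>I. 0 < \<eta> a} = card {a\<in>I. 0 < \<zeta> a}" using \<zeta>(2) by simp
    from permutes_of_card_eq[OF finite_I this]
    obtain p where p: "p permutes I" "\<And>a. a \<in> I \<Longrightarrow> (0 < \<zeta> a) = (0 < \<eta> (p a))" by metis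
    have "0 < \<zeta> a \<longleftrightarrow> 0 < \<eta> (p a)" for a
      using p \<zeta>(1) \<eta> by (cases "a \<in> I") (auto simp: X_def permutes_not_in)
    then have "cmean f (\<zeta> \<circ> q) = cmean f (\<eta> \<circ> p \<circ> q)" if "q permutes I" for q
      using \<zeta>(3) energy_comp[OF that] energy_comp[OF p(1)]
      by (intro cmean_cong) (auto simp: supp_def)
    then have "perm_avg I (cmean f) \<zeta> = perm_avg I (cmean f) (\<eta> \<circ> p)"
      unfolding perm_avg_def by (intro arg_cong[where f = "\<lambda>s. s / fact (card I)"], intro sum.cong refl) auto
    then show ?thesis by (simp add: perm_avg_comp[OF p(1)])
  qed
  let ?C = "{\<zeta>\<in>X. card (supp \<zeta>) = ?N \<and> energy \<zeta> = ?E}"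
  have C: "(\<Sum>\<zeta>\<in>X. ind.W \<zeta> * h \<zeta>) = (\<Sum>\<zeta>\<in>?C. mult \<zeta> * h \<zeta>)" for h
    using finite_X by (intro sum.mono_neutral_cong_right) (auto simp: ind.W_def)
  have "perm_avg I (cmean f) \<eta> * (\<Sum>\<zeta>\<in>?C. mult \<zeta>) = (\<Sum>\<zeta>\<in>?C. mult \<zeta> * perm_avg I (cmean f) \<zeta>)"
    unfolding sum_distrib_left by (intro sum.cong refl) (auto simp: const)
  also have "\<dots> = (\<Sum>\<zeta>\<in>X. ind.W \<zeta> * cmean f \<zeta>)"
    unfolding C[symmetric] by (rule ind.sites.sum_perm_avg) simp
  also have "\<dots> = (\<Sum>\<zeta>\<in>X. ind.W \<zeta> * f \<zeta>)"
    using ind.sum_W_cmean[of "\<lambda>_. 1" f] by simp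
  also have "\<dots> = 0" unfolding C by (rule zero)
  finally show ?thesis using sum_mult_pos[of ?C \<eta>] \<eta> by auto
qed

text \<open>\<open>lifted_gap\<close> with \<open>T = S\<close>, summed over all supports
  \<open>S\<close>. Pairs with an empty site may be added since their exchange term is 0.\<close>

lemma energy_step:
  "(\<Sum>\<eta>\<in>X. W \<eta> * (f \<eta>)\<^sup>2) \<le> (\<Sum>\<eta>\<in>X. W \<eta> * (cmean f \<eta>)\<^sup>2)
    + (\<Sum>y\<in>I. \<Sum>x\<in>{x\<in>I. x < y}. \<Sum>\<eta>\<in>X. W \<eta> * exchange f x y \<eta> / card {z\<in>supp \<eta>. z \<le> y})"
proof -
  let ?X = "\<lambda>S. {\<eta>\<in>X. supp \<eta> = S}"
  let ?T = "\<lambda>\<eta> x y. W \<eta> * exchange f x y \<eta> / card {z\<in>supp \<eta>. z \<le> y}"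
  have S: "(\<Sum>\<eta>\<in>?X S. W \<eta> * (f \<eta>)\<^sup>2) \<le> (\<Sum>\<eta>\<in>?X S. W \<eta> * (cmean f \<eta>)\<^sup>2)
     + (\<Sum>\<eta>\<in>?X S. \<Sum>y\<in>I. \<Sum>x\<in>{x\<in>I. x < y}. ?T \<eta> x y)" if S: "S \<subseteq> I" for S
  proof -
    have "(\<Sum>y\<in>S. \<Sum>x\<in>{x\<in>S. x < y}. (\<Sum>\<eta>\<in>?X S. W \<eta> * exchange f x y \<eta>) / card {z\<in>S. z \<le> y})
       = (\<Sum>y\<in>S. \<Sum>x\<in>{x\<in>S. x < y}. \<Sum>\<eta>\<in>?X S. ?T \<eta> x y)"
      unfolding sum_divide_distrib by (intro sum.cong refl) auto
    also have "\<dots> = (\<Sum>y\<in>S. \<Sum>x\<in>{x\<in>I. x < y}. \<Sum>\<eta>\<in>?X S. ?T \<eta> x y)"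
      using S finite_I by (intro sum.cong refl sum.mono_neutral_left)
        (auto intro!: sum.neutral simp: exchange_eq_0)
    also have "\<dots> = (\<Sum>y\<in>I. \<Sum>x\<in>{x\<in>I. x < y}. \<Sum>\<eta>\<in>?X S. ?T \<eta> x y)"
      using S finite_I by (intro sum.mono_neutral_left)
        (auto intro!: sum.neutral simp: exchange_eq_0)
    also have "\<dots> = (\<Sum>\<eta>\<in>?X S. \<Sum>y\<in>I. \<Sum>x\<in>{x\<in>I. x < y}. ?T \<eta> x y)"
      by (subst (2) sum.swap) (subst sum.swap, rule refl)
    finally have e: "(\<Sum>y\<in>S. \<Sum>x\<in>{x\<in>S. x < y}. (\<Sum>\<eta>\<in>?X S. W \<eta> * exchange f x y \<eta>) / card {z\<in>S. z \<le> y}) = \<dots>" .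
    have "(\<Sum>\<omega>\<in>occupations S. lift_weight S \<omega> * (perm_avg (subsites S) (\<lambda>\<omega>. f (cfg S \<omega>)) \<omega>)\<^sup>2)
        = (\<Sum>\<omega>\<in>occupations S. lift_weight S \<omega> * (cmean f (cfg S \<omega>))\<^sup>2)"
      by (intro sum.cong refl) (simp add: perm_avg_cmean[OF S])
    then show ?thesis using lifted_gap[OF S order_refl, of f] e
      by (simp add: lift_sum_W[OF S, of "\<lambda>\<eta>. (f \<eta>)\<^sup>2"] lift_sum_W[OF S, of "\<lambda>\<eta>. (cmean f \<eta>)\<^sup>2"])
  qed
  have "(\<Sum>\<eta>\<in>X. W \<eta> * (f \<eta>)\<^sup>2) \<le> (\<Sum>\<eta>\<in>X. W \<eta> * (cmean f \<eta>)\<^sup>2)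
     + (\<Sum>\<eta>\<in>X. \<Sum>y\<in>I. \<Sum>x\<in>{x\<in>I. x < y}. ?T \<eta> x y)"
    unfolding sum_X_supp[of "\<lambda>\<eta>. W \<eta> * (f \<eta>)\<^sup>2"] sum_X_supp[of "\<lambda>\<eta>. W \<eta> * (cmean f \<eta>)\<^sup>2"]
      sum_X_supp[of "\<lambda>\<eta>. \<Sum>y\<in>I. \<Sum>x\<in>{x\<in>I. x < y}. ?T \<eta> x y"]
    by (subst sum.distrib[symmetric], rule sum_mono, rule S) simp
  also have "(\<Sum>\<eta>\<in>X. \<Sum>y\<in>I. \<Sum>x\<in>{x\<in>I. x < y}. ?T \<eta> x y) = (\<Sum>y\<in>I. \<Sum>x\<in>{x\<in>I. x < y}. \<Sum>\<eta>\<in>X. ?T \<eta> x y)"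
    by (subst sum.swap) (subst (2) sum.swap, rule refl)
  finally show ?thesis .
qed

text \<open>The gap on sites is applied to \<open>cmean f\<close>, whose full symmetrisation
  vanishes; its variations are then bounded by those of \<open>f\<close>.\<close>

lemma position_step:
  assumes zero: "\<And>N E. (\<Sum>\<eta>\<in>{\<eta>\<in>X. card (supp \<eta>) = N \<and> energy \<eta> = E}. mult \<eta> * f \<eta>) = 0"
  shows "(\<Sum>\<eta>\<in>X. W \<eta> * (cmean f \<eta>)\<^sup>2)
    \<le> (\<Sum>y\<in>I. (\<Sum>x\<in>{x\<in>I. x < y}. sites.variation f (transpose y x)) / (2 * card {x\<in>I. x \<le> y}))"
proof -
  have "(\<Sum>\<eta>\<in>X. W \<eta> * (perm_avg I (cmean f) \<eta>)\<^sup>2) = 0"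
    by (intro sum.neutral ballI) (simp add: perm_avg_cmean_eq_0[OF zero])
  then have "(\<Sum>\<eta>\<in>X. W \<eta> * (cmean f \<eta>)\<^sup>2)
    \<le> (\<Sum>y\<in>I. (\<Sum>x\<in>{x\<in>I. x < y}. sites.variation (cmean f) (transpose y x)) / (2 * card {x\<in>I. x \<le> y}))"
    using transposition_gap[OF sites.perm_weight_axioms order_refl, of "cmean f"] by simp
  also have "\<dots> \<le> (\<Sum>y\<in>I. (\<Sum>x\<in>{x\<in>I. x < y}. sites.variation f (transpose y x)) / (2 * card {x\<in>I. x \<le> y}))"
    by (intro sum_mono divide_right_mono variation_cmean_le permutes_swap_id) auto
  finally show ?thesis .
qed

end

section \<open>Nearest neighbour moves\<close>

lemma perm_weight_subset:
  assumes "perm_weight I X w" "J \<subseteq> I" shows "perm_weight J X w"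
proof -
  interpret perm_weight I X w by fact
  show ?thesis
    using assms(2) finite_subset[OF _ finite_I] permutes_subset[of _ J I]
    by unfold_locales (auto simp: finite_X w_nonneg X_closed w_inv)
qed

context energy_chain
begin

text \<open>Detailed balance, seen on the subsites: the jump is a transposition, which preserves the
  weight and exchanges "a filled, b empty" with "b filled, a empty".\<close>

lemma reversibility_supp:
  assumes S: "S \<subseteq> I" and xy: "x \<noteq> y" "x \<in> S" "y \<in> S"
  shows "(\<Sum>\<eta>\<in>{\<eta>\<in>X. supp \<eta> = S}. W \<eta> * (rate_e (Suc m) \<eta> x y * h (move_config \<eta> x y)))
    = (\<Sum>\<eta>\<in>{\<eta>\<in>X. supp \<eta> = S}. W \<eta> * (rate_e (Suc m) \<eta> y x * h \<eta>))"
proof -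
  interpret L: perm_weight "subsites S" "occupations S" "lift_weight S" using S by (rule lift_perm_weight)
  have swap: "(\<Sum>\<omega>\<in>occupations S. \<Sum>b\<in>B. \<Sum>a\<in>A. g \<omega> b a) = (\<Sum>b\<in>B. \<Sum>a\<in>A. \<Sum>\<omega>\<in>occupations S. g \<omega> b a)"
    for A B :: "int set" and g :: "(int \<Rightarrow> bool) \<Rightarrow> int \<Rightarrow> int \<Rightarrow> real"
    by (subst sum.swap) (subst (2) sum.swap, rule refl)
  have step: "(\<Sum>\<omega>\<in>occupations S. lift_weight S \<omega> * (of_bool (\<omega> a \<and> \<not> \<omega> b) * h (move_config (cfg S \<omega>) x y)))
      = (\<Sum>\<omega>\<in>occupations S. lift_weight S \<omega> * (of_bool (\<omega> b \<and> \<not> \<omega> a) * h (cfg S \<omega>)))"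
    if ab: "a \<in> subsites {x}" "b \<in> subsites {y}" for a b
  proof -
    let ?t = "transpose b a"
    have t: "?t permutes subsites S" using ab xy by (intro permutes_swap_id) (auto simp: subsites_def)
    have "(\<Sum>\<omega>\<in>occupations S. lift_weight S \<omega> * (of_bool (\<omega> a \<and> \<not> \<omega> b) * h (move_config (cfg S \<omega>) x y)))
      = (\<Sum>\<omega>\<in>occupations S. lift_weight S \<omega> * (of_bool (\<omega> a \<and> \<not> \<omega> b) * h (cfg S (\<omega> \<circ> ?t))))"
    proof (intro sum.cong refl)
      fix \<omega>
      show "lift_weight S \<omega> * (of_bool (\<omega> a \<and> \<not> \<omega> b) * h (move_config (cfg S \<omega>) x y))
        = lift_weight S \<omega> * (of_bool (\<omega> a \<and> \<not> \<omega> b) * h (cfg S (\<omega> \<circ> ?t)))"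
        using cfg_transpose_move[OF xy ab, of \<omega>] by (cases "\<omega> a \<and> \<not> \<omega> b") simp_all
    qed
    also have "\<dots> = (\<Sum>\<omega>\<in>occupations S. lift_weight S \<omega> * (of_bool (\<omega> b \<and> \<not> \<omega> a) * h (cfg S \<omega>)))"
      using L.sum_comp_perm[OF t, of "\<lambda>\<omega>. of_bool (\<omega> b \<and> \<not> \<omega> a) * h (cfg S \<omega>)"] by simp
    finally show ?thesis .
  qed
  have "(\<Sum>\<omega>\<in>occupations S. lift_weight S \<omega> * (rate_e (Suc m) (cfg S \<omega>) x y * h (move_config (cfg S \<omega>) x y)))
      = (\<Sum>b\<in>subsites {y}. \<Sum>a\<in>subsites {x}. \<Sum>\<omega>\<in>occupations S. lift_weight S \<omega> * (of_bool (\<omega> a \<and> \<not> \<omega> b) * h (move_config (cfg S \<omega>) x y)))"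
    unfolding rate_e_cfg[OF xy(2,3)] swap[symmetric] by (simp only: sum_distrib_left sum_distrib_right)
  also have "\<dots> = (\<Sum>b\<in>subsites {y}. \<Sum>a\<in>subsites {x}. \<Sum>\<omega>\<in>occupations S. lift_weight S \<omega> * (of_bool (\<omega> b \<and> \<not> \<omega> a) * h (cfg S \<omega>)))"
    by (intro sum.cong refl step)
  also have "\<dots> = (\<Sum>a\<in>subsites {x}. \<Sum>b\<in>subsites {y}. \<Sum>\<omega>\<in>occupations S. lift_weight S \<omega> * (of_bool (\<omega> b \<and> \<not> \<omega> a) * h (cfg S \<omega>)))"
    by (rule sum.swap)
  also have "\<dots> = (\<Sum>\<omega>\<in>occupations S. lift_weight S \<omega> * (rate_e (Suc m) (cfg S \<omega>) y x * h (cfg S \<omega>)))"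
    unfolding rate_e_cfg[OF xy(3,2)] swap[symmetric] by (simp only: sum_distrib_left sum_distrib_right)
  finally show ?thesis
    by (simp add: lift_sum_W[OF S, of "\<lambda>\<eta>. rate_e (Suc m) \<eta> x y * h (move_config \<eta> x y)"]
        lift_sum_W[OF S, of "\<lambda>\<eta>. rate_e (Suc m) \<eta> y x * h \<eta>"])
qed

text \<open>Energy exchanges do not move particles, so a factor depending only on the support may be
  carried along; it will be the particle count in \<open>long_exchange_le\<close>.\<close>

lemma reversibility:
  assumes xy: "x \<noteq> y"
  shows "(\<Sum>\<eta>\<in>X. W \<eta> * (rate_e (Suc m) \<eta> x y * h (move_config \<eta> x y)) / g (supp \<eta>))
    = (\<Sum>\<eta>\<in>X. W \<eta> * (rate_e (Suc m) \<eta> y x * h \<eta>) / g (supp \<eta>))"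
proof -
  have "(\<Sum>\<eta>\<in>{\<eta>\<in>X. supp \<eta> = S}. W \<eta> * (rate_e (Suc m) \<eta> x y * h (move_config \<eta> x y)) / g (supp \<eta>))
    = (\<Sum>\<eta>\<in>{\<eta>\<in>X. supp \<eta> = S}. W \<eta> * (rate_e (Suc m) \<eta> y x * h \<eta>) / g (supp \<eta>))"
    if "S \<in> Pow I" for S
  proof (cases "x \<in> S \<and> y \<in> S")
    case True
    have "(\<Sum>\<eta>\<in>{\<eta>\<in>X. supp \<eta> = S}. W \<eta> * (rate_e (Suc m) \<eta> x y * h (move_config \<eta> x y)) / g S)
      = (\<Sum>\<eta>\<in>{\<eta>\<in>X. supp \<eta> = S}. W \<eta> * (rate_e (Suc m) \<eta> y x * h \<eta>) / g S)"
      using reversibility_supp[of S x y h] True xy that by (simp flip: sum_divide_distrib)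
    moreover have "(\<Sum>\<eta>\<in>{\<eta>\<in>X. supp \<eta> = S}. k \<eta> / g (supp \<eta>)) = (\<Sum>\<eta>\<in>{\<eta>\<in>X. supp \<eta> = S}. k \<eta> / g S)"
      for k :: "config \<Rightarrow> real" by (intro sum.cong) auto
    ultimately show ?thesis by (simp only:)
  next
    case False
    then have z: "rate_e (Suc m) \<eta> x y = 0" "rate_e (Suc m) \<eta> y x = 0" if "supp \<eta> = S" for \<eta>
      using that rate_e_eq_0 by blast+
    show ?thesis by (intro sum.cong refl) (auto simp: z)
  qed
  then show ?thesis unfolding sum_X_supp by (rule sum.cong[OF refl])
qed

lemma rate_e_le:
  assumes "\<eta> \<in> X"
  shows "rate_e (Suc m) \<eta> x y \<le> (real m)\<^sup>2 * occ \<eta> x" "rate_e (Suc m) \<eta> x y \<le> (real m)\<^sup>2 * occ \<eta> y"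
proof -
  have "(real (\<eta> x) - 1) * (real (Suc m) - real (\<eta> y)) \<le> real m * real m" if "\<eta> x \<ge> 1" "\<eta> y \<ge> 1"
    using that X_I[OF assms, of x] X_I[OF assms, of y] by (intro mult_mono) auto
  then show "rate_e (Suc m) \<eta> x y \<le> (real m)\<^sup>2 * occ \<eta> x" "rate_e (Suc m) \<eta> x y \<le> (real m)\<^sup>2 * occ \<eta> y"
    by (auto simp: rate_e_def occ_def power2_eq_square)
qed

lemma swap_config_eq: "swap_config \<eta> x y = \<eta> \<circ> transpose x y"
  by (auto simp: swap_config_def transpose_def fun_eq_iff)

definition form_p :: "(config \<Rightarrow> real) \<Rightarrow> int \<Rightarrow> int \<Rightarrow> real" where
  "form_p f x y = (\<Sum>\<eta>\<in>X. W \<eta> * (rate_p (Suc m) \<eta> x y * (f (swap_config \<eta> x y) - f \<eta>)\<^sup>2))"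

definition form_e :: "(config \<Rightarrow> real) \<Rightarrow> int \<Rightarrow> int \<Rightarrow> real" where
  "form_e f x y = (\<Sum>\<eta>\<in>X. W \<eta> * exchange f x y \<eta>)"

lemma form_e_nonneg: "0 \<le> form_e f x y"
  unfolding form_e_def by (intro sum_nonneg mult_nonneg_nonneg W_nonneg exchange_nonneg)

lemma form_p_nonneg: "0 \<le> form_p f x y"
  unfolding form_p_def
  by (intro sum_nonneg mult_nonneg_nonneg W_nonneg) (auto simp: rate_p_def occ_def)

text \<open>Two particles are swapped by energy exchanges (\<open>swap_pair\<close>); with one
  particle the swap is a particle jump, one of whose two rates is \<open>m \<ge> 1\<close>; with
  none it does nothing.\<close>

lemma swap_variation_le:
  assumes xy: "x < y"
  shows "sites.variation f (transpose x y) \<le> 2 * form_e f x y + form_p f x y + form_p f y x"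
proof -
  let ?D = "\<lambda>\<eta>. (f \<eta> - f (swap_config \<eta> x y))\<^sup>2"
  have one: "1 \<le> real m" using m_pos by simp
  have pt: "W \<eta> * ?D \<eta> \<le> W \<eta> * (of_bool (x \<in> supp \<eta> \<and> y \<in> supp \<eta>) * ?D \<eta>)
     + W \<eta> * (rate_p (Suc m) \<eta> x y * (f (swap_config \<eta> x y) - f \<eta>)\<^sup>2)
     + W \<eta> * (rate_p (Suc m) \<eta> y x * (f (swap_config \<eta> y x) - f \<eta>)\<^sup>2)" if "\<eta> \<in> X" for \<eta>
  proof -
    have sw: "swap_config \<eta> y x = swap_config \<eta> x y" by (simp add: swap_config_eq transpose_commute)
    have "?D \<eta> \<le> of_bool (x \<in> supp \<eta> \<and> y \<in> supp \<eta>) * ?D \<eta>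
       + rate_p (Suc m) \<eta> x y * ?D \<eta> + rate_p (Suc m) \<eta> y x * ?D \<eta>"
    proof (cases "x \<in> supp \<eta> \<longleftrightarrow> y \<in> supp \<eta>")
      case True
      show ?thesis
      proof (cases "x \<in> supp \<eta>")
        case True
        with \<open>x \<in> supp \<eta> \<longleftrightarrow> y \<in> supp \<eta>\<close> show ?thesis by (simp add: rate_p_def occ_def supp_def)
      next
        case False
        then have "swap_config \<eta> x y = \<eta>"
          using True by (auto simp: swap_config_def supp_def fun_eq_iff)
        then show ?thesis by simp
      qed
    next
      case False
      then have "rate_p (Suc m) \<eta> x y + rate_p (Suc m) \<eta> y x = real m"
        by (auto simp: rate_p_def occ_def supp_def)
      then have "rate_p (Suc m) \<eta> x y * ?D \<eta> + rate_p (Suc m) \<eta> y x * ?D \<eta> = real m * ?D \<eta>"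
        by (simp flip: distrib_right)
      moreover have "1 * ?D \<eta> \<le> real m * ?D \<eta>" using one by (intro mult_right_mono) auto
      ultimately show ?thesis using False by (simp add: mult.assoc)
    qed
    from mult_left_mono[OF this W_nonneg[OF that]] show ?thesis
      unfolding sw by (simp add: distrib_left power2_commute)
  qed
  have "sites.variation f (transpose x y) \<le> (\<Sum>\<eta>\<in>X. W \<eta> * (of_bool (x \<in> supp \<eta> \<and> y \<in> supp \<eta>) * ?D \<eta>))
      + form_p f x y + form_p f y x"
    unfolding sites.variation_def form_p_def sum.distrib[symmetric]
    by (rule sum_mono) (use pt in \<open>simp add: swap_config_eq\<close>)
  moreover have "(\<Sum>\<eta>\<in>X. W \<eta> * (of_bool (x \<in> supp \<eta> \<and> y \<in> supp \<eta>) * ?D \<eta>)) \<le> 2 * form_e f x y"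
  proof -
    have "(\<Sum>\<eta>\<in>{\<eta>\<in>X. supp \<eta> = S}. W \<eta> * (of_bool (x \<in> supp \<eta> \<and> y \<in> supp \<eta>) * ?D \<eta>))
       \<le> 2 * (\<Sum>\<eta>\<in>{\<eta>\<in>X. supp \<eta> = S}. W \<eta> * exchange f x y \<eta>)" if "S \<in> Pow I" for S
    proof (cases "x \<in> S \<and> y \<in> S")
      case True
      then have "(\<Sum>\<eta>\<in>{\<eta>\<in>X. supp \<eta> = S}. W \<eta> * (of_bool (x \<in> supp \<eta> \<and> y \<in> supp \<eta>) * ?D \<eta>))
        = (\<Sum>\<eta>\<in>{\<eta>\<in>X. supp \<eta> = S}. W \<eta> * ?D \<eta>)"
        by (intro sum.cong) auto
      then show ?thesis using swap_pair[of S x y f] xy True that by simp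
    next
      case False
      then have "(\<Sum>\<eta>\<in>{\<eta>\<in>X. supp \<eta> = S}. W \<eta> * (of_bool (x \<in> supp \<eta> \<and> y \<in> supp \<eta>) * ?D \<eta>)) = 0"
        by (intro sum.neutral) auto
      moreover have "0 \<le> (\<Sum>\<eta>\<in>{\<eta>\<in>X. supp \<eta> = S}. W \<eta> * exchange f x y \<eta>)"
        by (intro sum_nonneg mult_nonneg_nonneg W_nonneg exchange_nonneg) auto
      ultimately show ?thesis by simp
    qed
    then show ?thesis unfolding form_e_def sum_X_supp sum_distrib_left[of 2] by (rule sum_mono)
  qed
  ultimately show ?thesis by linarith
qed

definition bonds :: "int set" where "bonds = {b. b \<in> I \<and> b + 1 \<in> I}"

lemma finite_bonds: "finite bonds"
  using finite_I by (simp add: bonds_def)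

text \<open>The weight is general because both \<open>W\<close> and \<open>pair_weight\<close> are
  transported. Summing over all bonds, not only those of the path, allows the sum over pairs to be
  taken later at a fixed bond.\<close>

lemma path_bound:
  assumes xy: "x \<le> y" "{x..y} \<subseteq> I" and w: "perm_weight {x..y} X w"
  shows "perm_weight.variation X w f (transpose x y)
    \<le> 4 * real_of_int (y - x) * (\<Sum>b\<in>bonds. perm_weight.variation X w f (transpose b (b + 1)))"
proof -
  interpret w: perm_weight "{x..y}" X w by fact
  define d where "d = nat (y - x)"
  have y: "y = x + int d" using xy by (simp add: d_def)
  have "(\<Sum>j<d. w.variation f (transpose (x + int j) (x + int j + 1)))
      = (\<Sum>b\<in>(\<lambda>j. x + int j) ` {..<d}. w.variation f (transpose b (b + 1)))"
    by (subst sum.reindex) (auto simp: inj_on_def)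
  also have "\<dots> \<le> (\<Sum>b\<in>bonds. w.variation f (transpose b (b + 1)))"
    using xy(2) by (intro sum_mono2 finite_bonds w.variation_nonneg) (auto simp: bonds_def y)
  finally have "4 * real d * (\<Sum>j<d. w.variation f (transpose (x + int j) (x + int j + 1)))
     \<le> 4 * real d * (\<Sum>b\<in>bonds. w.variation f (transpose b (b + 1)))"
    by (intro mult_left_mono) auto
  moreover have "perm_weight {x..x + int d} X w" using w by (simp add: y)
  ultimately show ?thesis
    using variation_transpose_path[of x d X w f] by (simp add: y)
qed

section \<open>Energy exchanges at a distance\<close>

definition count_le :: "int \<Rightarrow> config \<Rightarrow> nat" where
  "count_le y \<eta> = card {z\<in>supp \<eta>. z \<le> y}"

text \<open>Of the conditions in the exchange rate only the occupation of \<open>x\<close> is kept.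
  Dropping that of \<open>y\<close> leaves a weight that is unchanged when the contents of the sites
  after \<open>x\<close> and up to \<open>y\<close> are permuted.\<close>

definition pair_weight :: "int \<Rightarrow> int \<Rightarrow> config \<Rightarrow> real" where
  "pair_weight x y \<eta> = W \<eta> * (of_bool (x \<in> supp \<eta>) / count_le y \<eta>)"

text \<open>Such a permutation fixes \<open>x\<close> and keeps every site on its side of
  \<open>y\<close>, so it changes neither the occupation of \<open>x\<close> nor the number of
  particles up to \<open>y\<close>.\<close>

lemma pair_weight_perm:
  assumes "{x<..y} \<subseteq> I" shows "perm_weight {x<..y} X (pair_weight x y)"
proof unfold_locales
  show "0 \<le> pair_weight x y \<eta>" if "\<eta> \<in> X" for \<eta>
    using W_nonneg[OF that] by (simp add: pair_weight_def)
  fix p \<eta> assume p: "p permutes {x<..y}" and \<eta>: "\<eta> \<in> X"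
  have pI: "p permutes I" using p assms permutes_subset by blast
  show "\<eta> \<circ> p \<in> X" using X_comp[OF pI \<eta>] .
  have px: "p x = x" using p by (auto simp: permutes_def)
  have le: "p z \<le> y \<longleftrightarrow> z \<le> y" for z
  proof (cases "z \<in> {x<..y}")
    case True
    then show ?thesis using permutes_in_image[OF p, of z] by auto
  qed (simp add: permutes_not_in[OF p])
  have "{z\<in>supp (\<eta> \<circ> p). z \<le> y} = p -` {z\<in>supp \<eta>. z \<le> y}"
    using le by (auto simp: supp_comp)
  then have "count_le y (\<eta> \<circ> p) = count_le y \<eta>"
    unfolding count_le_def
    using card_vimage_inj[OF permutes_inj[OF p], of "{z\<in>supp \<eta>. z \<le> y}"] permutes_surj[OF p] by simp
  then show "pair_weight x y (\<eta> \<circ> p) = pair_weight x y \<eta>"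
    using px sites.w_inv[OF pI \<eta>] by (simp add: pair_weight_def supp_comp)
qed (simp_all add: finite_X)

lemma pair_weight_le: "\<eta> \<in> X \<Longrightarrow> pair_weight x y \<eta> \<le> W \<eta>"
  using W_nonneg[of \<eta>] by (cases "count_le y \<eta>") (auto simp: pair_weight_def divide_simps distrib_left)

text \<open>There are at most \<open>count_le y \<eta>\<close> particles before \<open>y\<close>, so
  the shares add up to at most 1. This is where the factor 1 / N pays for the sum over
  \<open>x\<close>.\<close>

lemma sum_pair_weight_le:
  assumes \<eta>: "\<eta> \<in> X" shows "(\<Sum>x\<in>{x\<in>I. x < y}. pair_weight x y \<eta>) \<le> W \<eta>"
proof -
  have "(\<Sum>x\<in>{x\<in>I. x < y}. of_bool (x \<in> supp \<eta>)) = real (card {x\<in>supp \<eta>. x < y})"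
    using finite_I supp_subset[OF \<eta>]
    by (simp add: sum_of_bool_eq) (rule arg_cong[of _ _ card], auto)
  also have "\<dots> \<le> count_le y \<eta>"
    unfolding count_le_def using finite_supp[OF \<eta>] by (intro of_nat_mono card_mono) auto
  finally have "(\<Sum>x\<in>{x\<in>I. x < y}. of_bool (x \<in> supp \<eta>)) / count_le y \<eta> \<le> 1"
    by (cases "count_le y \<eta> = 0") (simp_all add: divide_le_eq_1)
  then have "W \<eta> * ((\<Sum>x\<in>{x\<in>I. x < y}. of_bool (x \<in> supp \<eta>)) / count_le y \<eta>) \<le> W \<eta> * 1"
    by (rule mult_left_mono) (rule W_nonneg[OF \<eta>])
  then show ?thesis
    by (simp add: pair_weight_def flip: sum_distrib_left sum_divide_distrib)
qed

text \<open>Bring the content of \<open>y\<close> next to \<open>x\<close>, exchange one unit of energy there, and undo the move.\<close>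
lemma long_exchange_le:
  assumes xy: "x < y" "{x..y} \<subseteq> I"
  shows "(\<Sum>\<eta>\<in>X. W \<eta> * exchange f x y \<eta> / count_le y \<eta>)
    \<le> 6 * (real m)\<^sup>2 * perm_weight.variation X (pair_weight x y) f (transpose (x + 1) y) + 3 * form_e f x (x + 1)"
proof -
  have J: "{x<..y} \<subseteq> I" using xy(2) by auto
  interpret w: perm_weight "{x<..y}" X "pair_weight x y" by (rule pair_weight_perm[OF J])
  let ?t = "transpose (x + 1) y"
  have t: "?t permutes {x<..y}" using xy by (intro permutes_swap_id) auto
  have tI: "?t permutes I" using t J permutes_subset by blast
  let ?A = "\<lambda>\<eta>. (f (move_config \<eta> x y) - f (move_config \<eta> x y \<circ> ?t))\<^sup>2"
  let ?B = "\<lambda>\<eta>. exchange f x (x + 1) (\<eta> \<circ> ?t)"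
  let ?C = "\<lambda>\<eta>. (f \<eta> - f (\<eta> \<circ> ?t))\<^sup>2"
  let ?r = "\<lambda>\<eta>. rate_e (Suc m) \<eta> x y"
  have occ_supp: "occ \<eta> x = of_bool (x \<in> supp \<eta>)" for \<eta> by (auto simp: occ_def supp_def)
  have mv: "move_config \<eta> x y \<circ> ?t = move_config (\<eta> \<circ> ?t) x (x + 1)" for \<eta>
    using xy by (auto simp: move_config_def fun_eq_iff transpose_def)
  have re: "rate_e (Suc m) (\<eta> \<circ> ?t) x (x + 1) = ?r \<eta>" for \<eta>
    using xy by (simp add: rate_e_def occ_def transpose_def)
  have sq: "(a - d)\<^sup>2 \<le> 3 * (a - b)\<^sup>2 + 3 * (b - c)\<^sup>2 + 3 * (d - c)\<^sup>2" for a b c d :: real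
  proof -
    have "0 \<le> ((a - b) - (b - c))\<^sup>2 + ((b - c) - (c - d))\<^sup>2 + ((a - b) - (c - d))\<^sup>2" by simp
    then show ?thesis by (simp add: power2_eq_square algebra_simps)
  qed
  have et: "exchange f x y \<eta> \<le> 3 * (?r \<eta> * ?A \<eta>) + 3 * ?B \<eta> + 3 * (?r \<eta> * ?C \<eta>)" if "\<eta> \<in> X" for \<eta>
    using mult_left_mono[OF sq[of "f (move_config \<eta> x y)" "f \<eta>" "f (move_config \<eta> x y \<circ> ?t)" "f (\<eta> \<circ> ?t)"]
        rate_e_nonneg[OF that, of x y]]
    unfolding exchange_def re mv by (simp add: algebra_simps)
  have "(\<Sum>\<eta>\<in>X. W \<eta> * exchange f x y \<eta> / count_le y \<eta>)
     \<le> (\<Sum>\<eta>\<in>X. W \<eta> * (3 * (?r \<eta> * ?A \<eta>) + 3 * ?B \<eta> + 3 * (?r \<eta> * ?C \<eta>)) / count_le y \<eta>)"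
    by (intro sum_mono divide_right_mono mult_left_mono et W_nonneg) auto
  also have "\<dots> = 3 * (\<Sum>\<eta>\<in>X. W \<eta> * (?r \<eta> * ?A \<eta>) / count_le y \<eta>)
     + 3 * (\<Sum>\<eta>\<in>X. W \<eta> * ?B \<eta> / count_le y \<eta>) + 3 * (\<Sum>\<eta>\<in>X. W \<eta> * (?r \<eta> * ?C \<eta>) / count_le y \<eta>)"
    unfolding sum_distrib_left sum.distrib[symmetric]
    by (intro sum.cong refl) (simp add: algebra_simps add_divide_distrib)
  finally have main: "(\<Sum>\<eta>\<in>X. W \<eta> * exchange f x y \<eta> / count_le y \<eta>) \<le> \<dots>" .
  \<comment> \<open>The rate \<open>r\<close> is left general because the bound serves both
    directions of the exchange; each rate is at most \<open>m\<close>^2 times the occupation of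
    \<open>x\<close>.\<close>
  have bound: "W \<eta> * (r * ?C \<eta>) / count_le y \<eta> \<le> (real m)\<^sup>2 * (pair_weight x y \<eta> * ?C \<eta>)"
    if "\<eta> \<in> X" "r \<le> (real m)\<^sup>2 * occ \<eta> x" for \<eta> r
  proof -
    have "W \<eta> * (r * ?C \<eta>) / count_le y \<eta> \<le> W \<eta> * (((real m)\<^sup>2 * occ \<eta> x) * ?C \<eta>) / count_le y \<eta>"
      using that W_nonneg by (intro divide_right_mono mult_left_mono mult_right_mono) auto
    then show ?thesis by (simp add: pair_weight_def occ_supp mult_ac)
  qed
  \<comment> \<open>Undoing the transport happens at the moved configuration; detailed balance
    brings this term back to \<open>\<eta>\<close>, with the reversed rate.\<close>
  have "(\<Sum>\<eta>\<in>X. W \<eta> * (?r \<eta> * ?A \<eta>) / count_le y \<eta>)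
      = (\<Sum>\<eta>\<in>X. W \<eta> * (rate_e (Suc m) \<eta> y x * ?C \<eta>) / count_le y \<eta>)"
    using reversibility[of x y ?C "\<lambda>S. real (card {z\<in>S. z \<le> y})"] xy by (simp add: count_le_def)
  also have "\<dots> \<le> (real m)\<^sup>2 * w.variation f ?t"
    unfolding w.variation_def sum_distrib_left
    by (intro sum_mono bound rate_e_le)
  finally have 1: "(\<Sum>\<eta>\<in>X. W \<eta> * (?r \<eta> * ?A \<eta>) / count_le y \<eta>) \<le> (real m)\<^sup>2 * w.variation f ?t" .
  have 3: "(\<Sum>\<eta>\<in>X. W \<eta> * (?r \<eta> * ?C \<eta>) / count_le y \<eta>) \<le> (real m)\<^sup>2 * w.variation f ?t"
    unfolding w.variation_def sum_distrib_left
    by (intro sum_mono bound rate_e_le)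
  \<comment> \<open>The exchange vanishes when \<open>x\<close> is empty, so the indicator in
    \<open>pair_weight\<close> can be inserted for free.\<close>
  have "(\<Sum>\<eta>\<in>X. W \<eta> * ?B \<eta> / count_le y \<eta>) = (\<Sum>\<eta>\<in>X. pair_weight x y \<eta> * ?B \<eta>)"
  proof (intro sum.cong refl)
    fix \<eta>
    have "x \<notin> supp \<eta> \<Longrightarrow> ?B \<eta> = 0" using xy by (intro exchange_eq_0) (simp add: supp_comp transpose_def)
    then show "W \<eta> * ?B \<eta> / count_le y \<eta> = pair_weight x y \<eta> * ?B \<eta>"
      by (cases "x \<in> supp \<eta>") (simp_all add: pair_weight_def)
  qed
  also have "\<dots> = (\<Sum>\<eta>\<in>X. pair_weight x y \<eta> * exchange f x (x + 1) \<eta>)"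
    by (rule w.sum_comp_perm[OF t])
  also have "\<dots> \<le> form_e f x (x + 1)"
    unfolding form_e_def by (intro sum_mono mult_right_mono pair_weight_le exchange_nonneg)
  finally have 2: "(\<Sum>\<eta>\<in>X. W \<eta> * ?B \<eta> / count_le y \<eta>) \<le> form_e f x (x + 1)" .
  show ?thesis using main 1 2 3 by linarith
qed


text \<open>For a fixed permutation the weights are added first, and together they stay below
  \<open>W\<close>: summing over \<open>x\<close> costs no factor.\<close>

lemma sum_pair_variation_le:
  "(\<Sum>x\<in>{x\<in>I. x < y}. perm_weight.variation X (pair_weight x y) f p) \<le> sites.variation f p"
  if "\<And>x. x \<in> I \<Longrightarrow> x < y \<Longrightarrow> {x<..y} \<subseteq> I"
proof -
  have "(\<Sum>x\<in>{x\<in>I. x < y}. perm_weight.variation X (pair_weight x y) f p)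
     = (\<Sum>x\<in>{x\<in>I. x < y}. \<Sum>\<eta>\<in>X. pair_weight x y \<eta> * (f \<eta> - f (\<eta> \<circ> p))\<^sup>2)"
    by (intro sum.cong refl perm_weight.variation_def[OF pair_weight_perm]) (use that in auto)
  also have "\<dots> = (\<Sum>\<eta>\<in>X. (\<Sum>x\<in>{x\<in>I. x < y}. pair_weight x y \<eta>) * (f \<eta> - f (\<eta> \<circ> p))\<^sup>2)"
    by (subst sum.swap) (simp add: sum_distrib_right)
  also have "\<dots> \<le> sites.variation f p"
    unfolding sites.variation_def by (intro sum_mono mult_right_mono sum_pair_weight_le) auto
  finally show ?thesis .
qed

end

section \<open>Collecting the powers of \<open>l\<close> on a segment\<close>

locale energy_segment = energy_chain +
  fixes l :: nat
  assumes I_eq: "I = {0..int l - 1}"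
begin

lemma interval_subset: "x \<in> I \<Longrightarrow> y \<in> I \<Longrightarrow> {x..y} \<subseteq> I" "x \<in> I \<Longrightarrow> y \<in> I \<Longrightarrow> {x<..y} \<subseteq> I"
  by (auto simp: I_eq)

lemma card_I: "card I = l"
  by (simp add: I_eq)

lemma bonds_eq: "bonds = {0..int l - 2}"
  unfolding bonds_def by (auto simp: I_eq)

definition total_variation :: "(config \<Rightarrow> real) \<Rightarrow> real" where
  "total_variation f = (\<Sum>b\<in>bonds. sites.variation f (transpose b (b + 1)))"

lemma total_variation_nonneg: "0 \<le> total_variation f"
  unfolding total_variation_def by (intro sum_nonneg sites.variation_nonneg)

text \<open>The path costs 4 (y - x) while the denominator is 2 (y + 1), so each pair costs at most
  twice \<open>total_variation f\<close>, and there are at most \<open>l\<close>^2 pairs.\<close>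

lemma position_le:
  "(\<Sum>y\<in>I. (\<Sum>x\<in>{x\<in>I. x < y}. sites.variation f (transpose y x)) / (2 * card {x\<in>I. x \<le> y}))
    \<le> 2 * (real l)\<^sup>2 * total_variation f"
proof -
  have cardle: "card {x\<in>I. x < y} \<le> l" for y
    using card_mono[OF finite_I, of "{x\<in>I. x < y}"] by (auto simp: card_I)
  have "(\<Sum>x\<in>{x\<in>I. x < y}. sites.variation f (transpose y x)) / (2 * card {x\<in>I. x \<le> y})
      \<le> l * (2 * total_variation f)" if y: "y \<in> I" for y
  proof -
    have c: "real (card {x\<in>I. x \<le> y}) = real_of_int y + 1"
    proof -
      have "{x\<in>I. x \<le> y} = {0..y}" using y by (auto simp: I_eq)
      then show ?thesis using y by (simp add: I_eq)
    qed
    have y0: "0 \<le> real_of_int y" using y by (simp add: I_eq)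
    have c2: "real (2 * card {x\<in>I. x \<le> y}) = 2 * (real_of_int y + 1)" using c by simp
    have "sites.variation f (transpose y x) / (2 * card {x\<in>I. x \<le> y}) \<le> 2 * total_variation f"
      if x: "x \<in> {x\<in>I. x < y}" for x
    proof -
      have incl: "{x..y} \<subseteq> I" using x y interval_subset by auto
      have "sites.variation f (transpose x y) \<le> 4 * real_of_int (y - x) * total_variation f"
        unfolding total_variation_def using x incl
        by (intro path_bound perm_weight_subset[OF sites.perm_weight_axioms]) auto
      also have "\<dots> \<le> 4 * (real_of_int y + 1) * total_variation f"
        using x by (intro mult_right_mono total_variation_nonneg) (auto simp: I_eq)
      finally show ?thesis unfolding c2 using y0
        by (simp add: transpose_commute[of y x] field_simps)
    qed
    then have "(\<Sum>x\<in>{x\<in>I. x < y}. sites.variation f (transpose y x)) / (2 * card {x\<in>I. x \<le> y})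
      \<le> (\<Sum>x\<in>{x\<in>I. x < y}. 2 * total_variation f)"
      unfolding sum_divide_distrib by (rule sum_mono)
    also have "\<dots> \<le> l * (2 * total_variation f)"
      using cardle[of y] total_variation_nonneg[of f] by (simp add: mult_right_mono)
    finally show ?thesis .
  qed
  then have "(\<Sum>y\<in>I. (\<Sum>x\<in>{x\<in>I. x < y}. sites.variation f (transpose y x)) / (2 * card {x\<in>I. x \<le> y}))
      \<le> (\<Sum>y\<in>I. l * (2 * total_variation f))" by (rule sum_mono)
  then show ?thesis by (simp add: card_I power2_eq_square mult_ac)
qed

text \<open>One factor \<open>l\<close> is the length of the path, the other the sum over
  \<open>y\<close>; the sum over \<open>x\<close> is absorbed by the weights. The constant 24 is 6
  from \<open>long_exchange_le\<close> times 4 from \<open>path_bound\<close>.\<close>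

lemma energy_le:
  "(\<Sum>y\<in>I. \<Sum>x\<in>{x\<in>I. x < y}. \<Sum>\<eta>\<in>X. W \<eta> * exchange f x y \<eta> / card {z\<in>supp \<eta>. z \<le> y})
    \<le> 24 * (real m)\<^sup>2 * (real l)\<^sup>2 * total_variation f + 3 * l * (\<Sum>b\<in>bonds. form_e f b (b + 1))"
proof -
  let ?V = "\<lambda>x y p. perm_weight.variation X (pair_weight x y) f p"
  have one: "(\<Sum>\<eta>\<in>X. W \<eta> * exchange f x y \<eta> / count_le y \<eta>)
      \<le> 24 * (real m)\<^sup>2 * l * (\<Sum>b\<in>bonds. ?V x y (transpose b (b + 1))) + 3 * form_e f x (x + 1)"
    if y: "y \<in> I" and x: "x \<in> {x\<in>I. x < y}" for x y
  proof -
    interpret w: perm_weight "{x<..y}" X "pair_weight x y"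
      using x y interval_subset by (intro pair_weight_perm) auto
    have incl: "{x + 1..y} \<subseteq> I" "{x..y} \<subseteq> I" using x y by (auto simp: I_eq)
    have nn: "0 \<le> (\<Sum>b\<in>bonds. ?V x y (transpose b (b + 1)))"
      by (intro sum_nonneg w.variation_nonneg)
    \<comment> \<open>The path starts at \<open>x + 1\<close>: \<open>pair_weight x y\<close> is
      known to be invariant only under permutations of \<open>{x<..y}\<close>.\<close>
    have "?V x y (transpose (x + 1) y) \<le> 4 * real_of_int (y - (x + 1)) * (\<Sum>b\<in>bonds. ?V x y (transpose b (b + 1)))"
      using x incl by (intro path_bound perm_weight_subset[OF w.perm_weight_axioms]) auto
    also have "\<dots> \<le> 4 * real l * (\<Sum>b\<in>bonds. ?V x y (transpose b (b + 1)))"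
      using x y nn by (intro mult_right_mono) (auto simp: I_eq)
    finally have "6 * (real m)\<^sup>2 * ?V x y (transpose (x + 1) y)
        \<le> 6 * (real m)\<^sup>2 * (4 * real l * (\<Sum>b\<in>bonds. ?V x y (transpose b (b + 1))))"
      by (intro mult_left_mono) auto
    moreover have "x < y" using x by simp
    ultimately show ?thesis using long_exchange_le[OF _ incl(2), of f] by (simp add: mult_ac)
  qed
  have two: "(\<Sum>x\<in>{x\<in>I. x < y}. \<Sum>\<eta>\<in>X. W \<eta> * exchange f x y \<eta> / count_le y \<eta>)
      \<le> 24 * (real m)\<^sup>2 * l * total_variation f + 3 * (\<Sum>b\<in>bonds. form_e f b (b + 1))" if y: "y \<in> I" for y
  proof -
    have "(\<Sum>x\<in>{x\<in>I. x < y}. \<Sum>\<eta>\<in>X. W \<eta> * exchange f x y \<eta> / count_le y \<eta>)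
      \<le> (\<Sum>x\<in>{x\<in>I. x < y}. 24 * (real m)\<^sup>2 * l * (\<Sum>b\<in>bonds. ?V x y (transpose b (b + 1))) + 3 * form_e f x (x + 1))"
      by (rule sum_mono) (rule one[OF y])
    also have "\<dots> = 24 * (real m)\<^sup>2 * l * (\<Sum>b\<in>bonds. \<Sum>x\<in>{x\<in>I. x < y}. ?V x y (transpose b (b + 1)))
        + 3 * (\<Sum>x\<in>{x\<in>I. x < y}. form_e f x (x + 1))"
      unfolding sum.swap[of _ _ bonds] by (simp only: sum.distrib sum_distrib_left[symmetric])
    also have "\<dots> \<le> 24 * (real m)\<^sup>2 * l * total_variation f + 3 * (\<Sum>b\<in>bonds. form_e f b (b + 1))"
    proof (intro add_mono mult_left_mono)
      show "(\<Sum>b\<in>bonds. \<Sum>x\<in>{x\<in>I. x < y}. ?V x y (transpose b (b + 1))) \<le> total_variation f"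
        unfolding total_variation_def
        using y interval_subset(2)[OF _ y] by (intro sum_mono sum_pair_variation_le) auto
      show "(\<Sum>x\<in>{x\<in>I. x < y}. form_e f x (x + 1)) \<le> (\<Sum>b\<in>bonds. form_e f b (b + 1))"
        using y unfolding bonds_eq
        by (intro sum_mono2 form_e_nonneg) (auto simp: I_eq)
    qed auto
    finally show ?thesis .
  qed
  have "(\<Sum>y\<in>I. \<Sum>x\<in>{x\<in>I. x < y}. \<Sum>\<eta>\<in>X. W \<eta> * exchange f x y \<eta> / count_le y \<eta>)
     \<le> (\<Sum>y\<in>I. 24 * (real m)\<^sup>2 * l * total_variation f + 3 * (\<Sum>b\<in>bonds. form_e f b (b + 1)))"
    by (rule sum_mono) (rule two)
  also have "\<dots> = 24 * (real m)\<^sup>2 * (real l)\<^sup>2 * total_variation f + 3 * l * (\<Sum>b\<in>bonds. form_e f b (b + 1))"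
    by (simp add: card_I power2_eq_square algebra_simps)
  finally show ?thesis by (simp add: count_le_def)
qed

text \<open>Energies and positions together give \<open>?c = 24 * m^2 + 2\<close> times the total
  variation, which is at most \<open>2 * ?E + ?P\<close>; the local exchanges add
  \<open>3 * ?E\<close>. Hence 2 ?c + 3 = 48 m^2 + 7, with \<open>?P\<close> enlarged to share this
  constant.\<close>

lemma spectral_gap:
  assumes zero: "\<And>N E. (\<Sum>\<eta>\<in>{\<eta>\<in>X. card (supp \<eta>) = N \<and> energy \<eta> = E}. mult \<eta> * f \<eta>) = 0"
  shows "(\<Sum>\<eta>\<in>X. W \<eta> * (f \<eta>)\<^sup>2) \<le> (48 * (real m)\<^sup>2 + 7) * (real l)\<^sup>2 *
    (\<Sum>b\<in>bonds. form_p f b (b + 1) + form_p f (b + 1) b + form_e f b (b + 1))"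
proof -
  let ?P = "\<Sum>b\<in>bonds. form_p f b (b + 1) + form_p f (b + 1) b"
  let ?E = "\<Sum>b\<in>bonds. form_e f b (b + 1)"
  let ?c = "24 * (real m)\<^sup>2 + 2"
  have P0: "0 \<le> ?P" by (intro sum_nonneg add_nonneg_nonneg form_p_nonneg)
  have E0: "0 \<le> ?E" by (intro sum_nonneg form_e_nonneg)
  have TV: "total_variation f \<le> 2 * ?E + ?P"
    unfolding total_variation_def sum_distrib_left sum.distrib[symmetric]
    by (rule sum_mono) (use swap_variation_le[of _ _ f] in \<open>simp add: add.assoc\<close>)
  have ll: "real l \<le> (real l)\<^sup>2" by (cases l) (auto simp: power2_eq_square)
  have "(\<Sum>\<eta>\<in>X. W \<eta> * (f \<eta>)\<^sup>2) \<le> ?c * (real l)\<^sup>2 * total_variation f + 3 * l * ?E"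
    using energy_step[of f] position_step[OF zero] position_le[of f] energy_le[of f]
    by (simp add: algebra_simps)
  also have "\<dots> \<le> ?c * (real l)\<^sup>2 * (2 * ?E + ?P) + 3 * (real l)\<^sup>2 * ?E"
    using TV E0 ll by (intro add_mono mult_left_mono mult_right_mono) auto
  also have "\<dots> \<le> ?c * (real l)\<^sup>2 * (2 * ?E + 2 * ?P) + 3 * (real l)\<^sup>2 * (?E + ?P)"
    using P0 by (intro add_mono mult_left_mono) auto
  also have "\<dots> = (48 * (real m)\<^sup>2 + 7) * (real l)\<^sup>2 * (?P + ?E)"
    by (simp add: algebra_simps)
  finally show ?thesis by (simp add: sum.distrib)
qed

end

section \<open>Product measures\<close>

text \<open>A polynomial with infinitely many zeros vanishes, and its coefficient at
  \<open>a\<close> collects the terms with exponent \<open>a\<close>.\<close>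

lemma power_sum_zero_coeffs:
  fixes c :: "'a \<Rightarrow> real"
  assumes A: "finite A" and zero: "\<And>z. 0 < z \<Longrightarrow> (\<Sum>x\<in>A. c x * z ^ u x) = 0"
  shows "(\<Sum>x\<in>{x\<in>A. u x = a}. c x) = 0"
proof -
  define p where "p = (\<Sum>x\<in>A. monom (c x) (u x))"
  have "poly p z = (\<Sum>x\<in>A. c x * z ^ u x)" for z by (simp add: p_def poly_sum poly_monom)
  then have "{0<..} \<subseteq> {z. poly p z = 0}" using zero by auto
  then have "p = 0"
    using poly_roots_finite[of p] finite_subset infinite_Ioi[of "0::real"] by blast
  then have "coeff p a = 0" by simp
  then show ?thesis using A by (simp add: p_def coeff_sum sum.inter_filter)
qed

lemma power_sum_zero_coeffs2:
  fixes c :: "'a \<Rightarrow> real"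
  assumes A: "finite A"
    and zero: "\<And>z t. 0 < z \<Longrightarrow> 0 < t \<Longrightarrow> (\<Sum>x\<in>A. c x * (z ^ u x * t ^ v x)) = 0"
  shows "(\<Sum>x\<in>{x\<in>A. u x = a \<and> v x = b}. c x) = 0"
proof -
  have "(\<Sum>x\<in>{x\<in>A. u x = a}. c x * t ^ v x) = 0" if "0 < t" for t
    by (rule power_sum_zero_coeffs[OF A]) (use zero[OF _ that] in \<open>simp add: mult_ac\<close>)
  then have "(\<Sum>x\<in>{x\<in>{x\<in>A. u x = a}. v x = b}. c x) = 0"
    using A by (intro power_sum_zero_coeffs[of "{x\<in>A. u x = a}" c v]) auto
  then show ?thesis by (simp add: conj_assoc)
qed

definition marginal :: "nat \<Rightarrow> real \<Rightarrow> real \<Rightarrow> nat \<Rightarrow> real" where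
  "marginal m \<rho> q k = (if k = 0 then 1 - \<rho> else \<rho> * (real (m choose (k - 1)) * (q ^ (k - 1) * (1 - q) ^ (Suc m - k))))"

lemma site_weight_marginal:
  assumes "0 < m" "\<rho> \<in> {0..1}" "\<E> \<in> {\<rho>..real (Suc m) * \<rho>}"
  obtains q where "q \<in> {0..1}" "site_weight (Suc m) \<rho> \<E> = marginal m \<rho> q"
proof (cases "\<rho> = 0")
  \<comment> \<open>Division by zero gives \<open>energy_param\<close> the value -1 / m here, which
    lies outside the unit interval, so \<open>q\<close> is chosen by hand.\<close>
  case True
  then have "site_weight (Suc m) \<rho> \<E> = marginal m \<rho> 0"
    by (auto simp: fun_eq_iff site_weight_def marginal_def)
  then show ?thesis using that[of 0] by simp
next
  case False
  then have pos: "0 < \<rho>" using assms by simp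
  let ?q = "energy_param (Suc m) \<rho> \<E>"
  have "1 \<le> \<E> / \<rho>" "\<E> / \<rho> \<le> real (Suc m)" using assms pos by (simp_all add: field_simps)
  then have "?q \<in> {0..1}" using assms(1) by (simp add: energy_param_def)
  moreover have "site_weight (Suc m) \<rho> \<E> = marginal m \<rho> ?q"
    by (auto simp: fun_eq_iff site_weight_def marginal_def)
  ultimately show ?thesis using that by blast
qed

lemma marginal_nonneg: "\<rho> \<in> {0..1} \<Longrightarrow> q \<in> {0..1} \<Longrightarrow> 0 \<le> marginal m \<rho> q k"
  by (simp add: marginal_def)

lemma sum_marginal: "(\<Sum>k\<in>{0..Suc m}. marginal m \<rho> q k) = 1"
proof -
  have "(\<Sum>k\<in>{0..Suc m}. marginal m \<rho> q k) = (1 - \<rho>) + (\<Sum>j\<in>{0..m}. marginal m \<rho> q (Suc j))"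
    by (subst sum.atLeast0_atMost_Suc_shift) (simp add: marginal_def)
  also have "(\<Sum>j\<in>{0..m}. marginal m \<rho> q (Suc j)) = \<rho> * (\<Sum>j\<le>m. real (m choose j) * q ^ j * (1 - q) ^ (m - j))"
    by (simp add: marginal_def sum_distrib_left mult.assoc atMost_atLeast0)
  also have "(\<Sum>j\<le>m. real (m choose j) * q ^ j * (1 - q) ^ (m - j)) = (q + (1 - q)) ^ m"
    by (rule binomial_ring[symmetric])
  finally show ?thesis by simp
qed

text \<open>Probability of one configuration on \<open>n\<close> sites with \<open>N\<close>
  particles and energy \<open>E\<close>, stripped of \<open>mult\<close>. The last two exponents are
  the total numbers of filled and of empty subsites.\<close>

definition class_weight :: "nat \<Rightarrow> real \<Rightarrow> real \<Rightarrow> nat \<Rightarrow> nat \<Rightarrow> nat \<Rightarrow> real" where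
  "class_weight m \<rho> q n N E = (1 - \<rho>) ^ (n - N) * \<rho> ^ N * (q ^ (E - N) * (1 - q) ^ (Suc m * N - E))"

lemma class_weight_nonneg: "\<rho> \<in> {0..1} \<Longrightarrow> q \<in> {0..1} \<Longrightarrow> 0 \<le> class_weight m \<rho> q n N E"
  by (simp add: class_weight_def)

context energy_chain
begin

lemma energy_supp: "\<eta> \<in> X \<Longrightarrow> energy \<eta> = (\<Sum>x\<in>supp \<eta>. \<eta> x)"
  unfolding energy_def using supp_subset[of \<eta>] finite_I
  by (intro sum.mono_neutral_right) (auto simp: supp_def)

lemma energy_bounds:
  assumes "\<eta> \<in> X"
  shows "card (supp \<eta>) \<le> energy \<eta>" "energy \<eta> \<le> Suc m * card (supp \<eta>)"
proof -
  show "card (supp \<eta>) \<le> energy \<eta>"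
    unfolding energy_supp[OF assms] using sum_mono[of "supp \<eta>" "\<lambda>_. 1" \<eta>] by (simp add: supp_def)
  show "energy \<eta> \<le> Suc m * card (supp \<eta>)"
    unfolding energy_supp[OF assms] using sum_mono[of "supp \<eta>" \<eta> "\<lambda>_. Suc m"] X_I[OF assms]
    by (simp add: mult.commute)
qed

lemma prod_marginal:
  assumes \<eta>: "\<eta> \<in> X"
  shows "(\<Prod>x\<in>I. marginal m \<rho> q (\<eta> x)) = class_weight m \<rho> q (card I) (card (supp \<eta>)) (energy \<eta>) * mult \<eta>"
proof -
  let ?S = "supp \<eta>"
  have fS: "finite ?S" and SI: "?S \<subseteq> I" using finite_supp[OF \<eta>] supp_subset[OF \<eta>] by auto
  have "(\<Prod>x\<in>I. marginal m \<rho> q (\<eta> x)) = (\<Prod>x\<in>I - ?S. marginal m \<rho> q (\<eta> x)) * (\<Prod>x\<in>?S. marginal m \<rho> q (\<eta> x))"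
    by (rule prod.subset_diff[OF SI finite_I])
  also have "(\<Prod>x\<in>I - ?S. marginal m \<rho> q (\<eta> x)) = (\<Prod>x\<in>I - ?S. 1 - \<rho>)"
    by (intro prod.cong refl) (auto simp: marginal_def supp_def)
  also have "\<dots> = (1 - \<rho>) ^ (card I - card ?S)"
    using fS SI by (simp add: card_Diff_subset)
  also have "(\<Prod>x\<in>?S. marginal m \<rho> q (\<eta> x))
      = (\<Prod>x\<in>?S. \<rho> * (real (m choose (\<eta> x - 1)) * (q ^ (\<eta> x - 1) * (1 - q) ^ (Suc m - \<eta> x))))"
    by (intro prod.cong refl) (auto simp: marginal_def supp_def)
  also have "\<dots> = \<rho> ^ card ?S * ((\<Prod>x\<in>?S. real (m choose (\<eta> x - 1)))
      * (q ^ (\<Sum>x\<in>?S. \<eta> x - 1) * (1 - q) ^ (\<Sum>x\<in>?S. Suc m - \<eta> x)))"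
    by (simp add: prod.distrib power_sum)
  also have "(\<Sum>x\<in>?S. \<eta> x - 1) = energy \<eta> - card ?S"
    unfolding energy_supp[OF \<eta>] by (subst sum_subtractf_nat) (auto simp: supp_def)
  also have "(\<Sum>x\<in>?S. Suc m - \<eta> x) = Suc m * card ?S - energy \<eta>"
    unfolding energy_supp[OF \<eta>] by (subst sum_subtractf_nat) (auto simp: X_I[OF \<eta>] mult.commute)
  also have "(\<Prod>x\<in>?S. real (m choose (\<eta> x - 1))) = mult \<eta>"
    unfolding mult_def using SI finite_I by (intro prod.mono_neutral_cong_left) (auto simp: supp_def)
  finally show ?thesis by (simp add: class_weight_def mult_ac)
qed

lemma class_sums_zero:
  assumes zero: "\<And>\<rho> q. \<rho> \<in> {0<..1} \<Longrightarrow> q \<in> {0..1} \<Longrightarrow> (\<Sum>\<eta>\<in>X. (\<Prod>x\<in>I. marginal m \<rho> q (\<eta> x)) * f \<eta>) = 0"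
  shows "(\<Sum>\<eta>\<in>{\<eta>\<in>X. card (supp \<eta>) = N \<and> energy \<eta> = E}. mult \<eta> * f \<eta>) = 0"
proof -
  let ?n = "card I"
  have "(\<Sum>\<eta>\<in>X. (mult \<eta> * f \<eta>) * (z ^ card (supp \<eta>) * t ^ (energy \<eta> - card (supp \<eta>)))) = 0"
    if z: "0 < z" and t: "0 < t" for z t :: real
  proof -
    \<comment> \<open>Solves t = q / (1 - q) and z = (1 - q)^m \<rho> / (1 - \<rho>). In these
      variables the class weight is a monomial in \<open>z\<close> and \<open>t\<close>, divided by
      the common factor \<open>(1 + s) ^ ?n\<close>.\<close>
    define q s \<rho> where "q = t / (1 + t)" and "s = z * (1 + t) ^ m" and "\<rho> = s / (1 + s)"
    have s: "0 < s" using z t by (simp add: s_def)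
    have q1: "1 - q = 1 / (1 + t)" and r1: "1 - \<rho> = 1 / (1 + s)"
      using t s by (simp_all add: q_def \<rho>_def field_simps)
    have cw: "class_weight m \<rho> q ?n (card (supp \<eta>)) (energy \<eta>)
      = (z ^ card (supp \<eta>) * t ^ (energy \<eta> - card (supp \<eta>))) / (1 + s) ^ ?n" if \<eta>: "\<eta> \<in> X" for \<eta>
    proof -
      let ?N = "card (supp \<eta>)" and ?E = "energy \<eta>"
      have le: "?N \<le> ?n" using card_mono[OF finite_I supp_subset[OF \<eta>]] .
      have "(1 - \<rho>) ^ (?n - ?N) * \<rho> ^ ?N = s ^ ?N / ((1 + s) ^ (?n - ?N) * (1 + s) ^ ?N)"
        unfolding r1 by (simp add: \<rho>_def power_divide)
      also have "\<dots> = s ^ ?N / (1 + s) ^ ?n" using le by (simp flip: power_add)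
      finally have A: "(1 - \<rho>) ^ (?n - ?N) * \<rho> ^ ?N = s ^ ?N / (1 + s) ^ ?n" .
      have e: "?E - ?N + (Suc m * ?N - ?E) = m * ?N" using energy_bounds[OF \<eta>] by simp
      have "q ^ (?E - ?N) * (1 - q) ^ (Suc m * ?N - ?E)
          = t ^ (?E - ?N) / ((1 + t) ^ (?E - ?N) * (1 + t) ^ (Suc m * ?N - ?E))"
        unfolding q1 by (simp add: q_def power_divide)
      also have "\<dots> = t ^ (?E - ?N) / (1 + t) ^ (m * ?N)" unfolding power_add[symmetric] e ..
      finally have B: "q ^ (?E - ?N) * (1 - q) ^ (Suc m * ?N - ?E) = t ^ (?E - ?N) / (1 + t) ^ (m * ?N)" .
      have "s ^ ?N = z ^ ?N * (1 + t) ^ (m * ?N)" by (simp add: s_def power_mult_distrib power_mult)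
      then show ?thesis unfolding class_weight_def A B using t by simp
    qed
    have "\<rho> \<in> {0<..1}" "q \<in> {0..1}" using s t by (simp_all add: \<rho>_def q_def)
    from zero[OF this]
    have "0 = (\<Sum>\<eta>\<in>X. (mult \<eta> * f \<eta>) * (z ^ card (supp \<eta>) * t ^ (energy \<eta> - card (supp \<eta>)))) / (1 + s) ^ ?n"
      by (simp add: prod_marginal cw sum_divide_distrib mult_ac cong: sum.cong)
    then show ?thesis using s by simp
  qed
  then have *: "(\<Sum>\<eta>\<in>{\<eta>\<in>X. card (supp \<eta>) = N \<and> energy \<eta> - card (supp \<eta>) = E - N}. mult \<eta> * f \<eta>) = 0"
    by (rule power_sum_zero_coeffs2[OF finite_X])
  show ?thesis
  \<comment> \<open>The exponent \<open>E - N\<close> truncates for \<open>E < N\<close>, but then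
    the class is empty, since every particle has energy at least 1.\<close>
  proof (cases "N \<le> E")
    case True
    then have "{\<eta>\<in>X. card (supp \<eta>) = N \<and> energy \<eta> - card (supp \<eta>) = E - N}
      = {\<eta>\<in>X. card (supp \<eta>) = N \<and> energy \<eta> = E}" using energy_bounds(1) by fastforce
    then show ?thesis using * by simp
  next
    case False
    then have "{\<eta>\<in>X. card (supp \<eta>) = N \<and> energy \<eta> = E} = {}" using energy_bounds(1) by fastforce
    then show ?thesis by (simp only: sum.empty)
  qed
qed

text \<open>On the space of the measure, a function supported in \<open>I\<close> is a finite
  combination of indicators of cylinders, one for each element of \<open>X\<close>; integrability
  comes with this form.\<close>

lemma integral_prod_meas:
  assumes nonneg: "\<And>k. 0 \<le> site_weight (Suc m) \<rho> \<E> k"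
    and sum1: "(\<Sum>k\<in>{0..Suc m}. site_weight (Suc m) \<rho> \<E> k) = 1"
    and h: "supported_in (Suc m) I h"
  shows "(LINT \<eta>|prod_meas (Suc m) \<rho> \<E>. h \<eta>) = (\<Sum>\<eta>\<in>X. (\<Prod>x\<in>I. site_weight (Suc m) \<rho> \<E> (\<eta> x)) * h \<eta>)"
proof -
  let ?w = "site_weight (Suc m) \<rho> \<E>"
  let ?P = "point_measure {0..Suc m} (\<lambda>k. ennreal (?w k))"
  let ?M = "prod_meas (Suc m) \<rho> \<E>"
  have "emeasure ?P (space ?P) = 1"
    using sum_ennreal[of "{0..Suc m}" ?w] nonneg sum1
    by (simp add: space_point_measure emeasure_point_measure_finite del: sum.atLeast0_atMost_Suc)
  then interpret P: prob_space ?P by (rule prob_spaceI)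
  interpret prod: product_prob_space "\<lambda>_::int. ?P" UNIV by unfold_locales
  have space_M: "space ?M = configs (Suc m)"
    by (auto simp: prod_meas_def space_PiM space_point_measure configs_def PiE_def Pi_def)
  define cyl where "cyl \<zeta> = {\<eta>\<in>space ?M. \<forall>x\<in>I. \<eta> x = \<zeta> x}" for \<zeta> :: config
  have cyl_eq: "cyl \<zeta> = {\<eta>\<in>space ?M. \<forall>x\<in>I. \<eta> x \<in> {\<zeta> x}}" for \<zeta> by (simp add: cyl_def)
  have in_sets: "{\<zeta> x} \<in> sets ?P" if "\<zeta> \<in> X" for \<zeta> x
    using X_I[OF that, of x] by (simp add: sets_point_measure)
  have sets: "cyl \<zeta> \<in> sets ?M" if "\<zeta> \<in> X" for \<zeta>
  proof -
    have "cyl \<zeta> = prod_emb UNIV (\<lambda>_. ?P) I (PiE I (\<lambda>x. {\<zeta> x}))"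
      unfolding cyl_eq prod_emb_def prod_meas_def by (auto simp: space_PiM Pi_iff)
    then show ?thesis unfolding prod_meas_def
      using in_sets[OF that] finite_I by (simp add: sets_PiM_I)
  qed
  have "emeasure ?M (cyl \<zeta>) = ennreal (\<Prod>x\<in>I. ?w (\<zeta> x))" if "\<zeta> \<in> X" for \<zeta>
  proof -
    have "emeasure ?M (cyl \<zeta>) = (\<Prod>x\<in>I. emeasure ?P {\<zeta> x})"
      unfolding cyl_eq prod_meas_def using in_sets[OF that] finite_I
      by (intro prod.emeasure_PiM_Collect) auto
    also have "\<dots> = (\<Prod>x\<in>I. ennreal (?w (\<zeta> x)))"
      using X_I[OF that] by (intro prod.cong refl) (simp add: emeasure_point_measure_finite)
    finally show ?thesis by (simp add: prod_ennreal nonneg)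
  qed
  then have meas: "measure ?M (cyl \<zeta>) = (\<Prod>x\<in>I. ?w (\<zeta> x))" "emeasure ?M (cyl \<zeta>) < \<infinity>" if "\<zeta> \<in> X" for \<zeta>
    using that by (simp_all add: measure_def nonneg prod_nonneg)
  have X_configs: "\<zeta> \<in> configs (Suc m)" if "\<zeta> \<in> X" for \<zeta>
    using X_I[OF that] by (simp add: configs_def)
  have "h \<eta> = (\<Sum>\<zeta>\<in>X. h \<zeta> * indicator (cyl \<zeta>) \<eta>)" if \<eta>: "\<eta> \<in> space ?M" for \<eta>
  proof -
    define \<zeta>0 :: config where "\<zeta>0 = (\<lambda>x. if x \<in> I then \<eta> x else 0)"
    have \<zeta>0: "\<zeta>0 \<in> X" using \<eta> by (auto simp: space_M configs_def \<zeta>0_def X_def)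
    have uniq: "\<zeta> = \<zeta>0" if "\<zeta> \<in> X" "\<forall>x\<in>I. \<eta> x = \<zeta> x" for \<zeta>
    proof
      fix x show "\<zeta> x = \<zeta>0 x"
        using that by (cases "x \<in> I") (auto simp: X_def \<zeta>0_def)
    qed
    have "(\<Sum>\<zeta>\<in>X. h \<zeta> * indicator (cyl \<zeta>) \<eta>) = (\<Sum>\<zeta>\<in>X. if \<zeta> = \<zeta>0 then h \<zeta>0 else 0)"
    proof (intro sum.cong refl)
      fix \<zeta> assume "\<zeta> \<in> X"
      have "\<eta> \<in> cyl \<zeta>0" using \<eta> by (simp add: cyl_def \<zeta>0_def)
      moreover have "\<eta> \<notin> cyl \<zeta>" if "\<zeta> \<noteq> \<zeta>0" using uniq[OF \<open>\<zeta> \<in> X\<close>] that by (auto simp: cyl_def)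
      ultimately show "h \<zeta> * indicator (cyl \<zeta>) \<eta> = (if \<zeta> = \<zeta>0 then h \<zeta>0 else 0)" by simp
    qed
    also have "\<dots> = h \<zeta>0" using finite_X \<zeta>0 by simp
    also have "\<dots> = h \<eta>"
      by (rule h[unfolded supported_in_def, rule_format, OF X_configs[OF \<zeta>0] \<eta>[unfolded space_M]])
         (simp add: \<zeta>0_def)
    finally show ?thesis by simp
  qed
  then have "(LINT \<eta>|?M. h \<eta>) = (LINT \<eta>|?M. (\<Sum>\<zeta>\<in>X. h \<zeta> * indicator (cyl \<zeta>) \<eta>))"
    by (intro Bochner_Integration.integral_cong) auto
  also have "\<dots> = (\<Sum>\<zeta>\<in>X. h \<zeta> * measure ?M (cyl \<zeta>))"
    using sets meas by (subst Bochner_Integration.integral_sum) (auto intro!: sum.cong)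
  finally show ?thesis using meas by (simp add: mult.commute cong: sum.cong)
qed

end

lemma supported_power2: "supported_in \<kappa> A f \<Longrightarrow> supported_in \<kappa> A (\<lambda>\<eta>. (f \<eta>)\<^sup>2)"
  unfolding supported_in_def by metis

lemma supported_dirichlet_p:
  assumes f: "supported_in \<kappa> A f" and "x \<in> A" "y \<in> A"
  shows "supported_in \<kappa> A (\<lambda>\<eta>. rate_p \<kappa> \<eta> x y * (f (swap_config \<eta> x y) - f \<eta>)\<^sup>2)"
  unfolding supported_in_def
proof (intro ballI impI)
  fix \<eta> \<zeta> assume c: "\<eta> \<in> configs \<kappa>" "\<zeta> \<in> configs \<kappa>" and eq: "\<forall>x\<in>A. \<eta> x = \<zeta> x"
  have "f (swap_config \<eta> x y) = f (swap_config \<zeta> x y)"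
  proof -
    have "swap_config \<eta> x y \<in> configs \<kappa>" "swap_config \<zeta> x y \<in> configs \<kappa>"
      using c by (auto simp: swap_config_def configs_def)
    moreover have "\<forall>z\<in>A. swap_config \<eta> x y z = swap_config \<zeta> x y z"
      using eq assms by (auto simp: swap_config_def)
    ultimately show ?thesis using f unfolding supported_in_def by blast
  qed
  moreover have "f \<eta> = f \<zeta>" using f c eq unfolding supported_in_def by blast
  ultimately show "rate_p \<kappa> \<eta> x y * (f (swap_config \<eta> x y) - f \<eta>)\<^sup>2
    = rate_p \<kappa> \<zeta> x y * (f (swap_config \<zeta> x y) - f \<zeta>)\<^sup>2"
    using eq assms by (simp add: rate_p_def occ_def)
qed

lemma supported_dirichlet_e:
  assumes f: "supported_in \<kappa> A f" and "x \<in> A" "y \<in> A"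
  shows "supported_in \<kappa> A (\<lambda>\<eta>. rate_e \<kappa> \<eta> x y * (f (move_config \<eta> x y) - f \<eta>)\<^sup>2)"
  unfolding supported_in_def
proof (intro ballI impI)
  fix \<eta> \<zeta> assume c: "\<eta> \<in> configs \<kappa>" "\<zeta> \<in> configs \<kappa>" and eq: "\<forall>x\<in>A. \<eta> x = \<zeta> x"
  have rate: "rate_e \<kappa> \<eta> x y = rate_e \<kappa> \<zeta> x y" using eq assms by (simp add: rate_e_def occ_def)
  have f\<eta>: "f \<eta> = f \<zeta>" using f c eq unfolding supported_in_def by blast
  show "rate_e \<kappa> \<eta> x y * (f (move_config \<eta> x y) - f \<eta>)\<^sup>2
    = rate_e \<kappa> \<zeta> x y * (f (move_config \<zeta> x y) - f \<zeta>)\<^sup>2"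
  \<comment> \<open>At the maximal value the moved configuration leaves
    \<open>configs \<kappa>\<close>, where \<open>supported_in\<close> says nothing about
    \<open>f\<close>; the rate vanishes there.\<close>
  proof (cases "\<eta> y = \<kappa>")
    case True
    then show ?thesis unfolding rate[symmetric] by (simp add: rate_e_def)
  next
    case False
    then have "\<eta> y < \<kappa>" "\<zeta> y < \<kappa>" using c eq assms by (auto simp: configs_def le_less)
    then have "move_config \<eta> x y \<in> configs \<kappa>" "move_config \<zeta> x y \<in> configs \<kappa>"
      using c by (auto simp: move_config_def configs_def intro: le_trans[OF diff_le_self])
    moreover have "\<forall>z\<in>A. move_config \<eta> x y z = move_config \<zeta> x y z"
      using eq assms by (auto simp: move_config_def)
    ultimately have "f (move_config \<eta> x y) = f (move_config \<zeta> x y)"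
      using f unfolding supported_in_def by blast
    then show ?thesis by (simp add: rate f\<eta>)
  qed
qed

lemma sum_neighbour_pairs:
  fixes g :: "int \<Rightarrow> int \<Rightarrow> real"
  assumes "finite I"
  shows "(\<Sum>(x, y)\<in>{(x, y). x \<in> I \<and> y \<in> I \<and> \<bar>x - y\<bar> = 1}. g x y)
    = (\<Sum>b\<in>{b. b \<in> I \<and> b + 1 \<in> I}. g b (b + 1) + g (b + 1) b)"
proof -
  let ?B = "{b. b \<in> I \<and> b + 1 \<in> I}"
  have A: "{(x, y). x \<in> I \<and> y \<in> I \<and> \<bar>x - y\<bar> = 1} = (\<lambda>b. (b, b + 1)) ` ?B \<union> (\<lambda>b. (b + 1, b)) ` ?B"
    (is "?A = _")
  proof
    show "?A \<subseteq> (\<lambda>b. (b, b + 1)) ` ?B \<union> (\<lambda>b. (b + 1, b)) ` ?B"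
    proof (clarify)
      fix x y :: int assume a: "x \<in> I" "y \<in> I" "\<bar>x - y\<bar> = 1" "(x, y) \<notin> (\<lambda>b. (b + 1, b)) ` ?B"
      then have "y = x + 1 \<or> x = y + 1" by linarith
      then show "(x, y) \<in> (\<lambda>b. (b, b + 1)) ` ?B" using a by auto
    qed
  qed auto
  have "(\<Sum>(x, y)\<in>?A. g x y) = (\<Sum>(x, y)\<in>(\<lambda>b. (b, b + 1)) ` ?B. g x y) + (\<Sum>(x, y)\<in>(\<lambda>b. (b + 1, b)) ` ?B. g x y)"
    unfolding A
  proof (rule sum.union_disjoint)
    have "finite ?B" using assms by simp
    then show "finite ((\<lambda>b. (b, b + 1)) ` ?B)" "finite ((\<lambda>b. (b + 1, b)) ` ?B)" by (rule finite_imageI)+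
    show "(\<lambda>b. (b, b + 1)) ` ?B \<inter> (\<lambda>b. (b + 1, b)) ` ?B = {}"
    proof (rule equals0I)
      fix p assume "p \<in> (\<lambda>b. (b, b + 1)) ` ?B \<inter> (\<lambda>b. (b + 1, b)) ` ?B"
      then have "snd p = fst p + 1" "fst p = snd p + 1" by force+
      then show False by linarith
    qed
  qed
  also have "\<dots> = (\<Sum>b\<in>?B. g b (b + 1)) + (\<Sum>b\<in>?B. g (b + 1) b)"
  proof -
    have i: "inj_on (\<lambda>b::int. (b, b + 1)) ?B" by (rule inj_on_inverseI[of _ fst]) simp
    have j: "inj_on (\<lambda>b::int. (b + 1, b)) ?B" by (rule inj_on_inverseI[of _ snd]) simp
    show ?thesis unfolding sum.reindex[OF i] sum.reindex[OF j] o_def prod.case ..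
  qed
  finally show ?thesis by (simp add: sum.distrib)
qed

theorem proposition22:
  fixes \<kappa> :: nat
  assumes "\<kappa> \<ge> 2"
  shows "\<exists>C::real. C > 0 \<and>
    (\<forall>(l::nat) (f :: config \<Rightarrow> real).
       l \<ge> 1 \<longrightarrow>
       supported_in \<kappa> {0..int l - 1} f \<longrightarrow>
       (\<forall>\<rho>\<in>{0..1}. \<forall>\<E>\<in>{\<rho>..real \<kappa> * \<rho>}. psi \<kappa> f \<rho> \<E> = 0) \<longrightarrow>
       (\<forall>\<rho>\<in>{0..1}. \<forall>\<E>\<in>{\<rho>..real \<kappa> * \<rho>}.
          prob_space.variance (prod_meas \<kappa> \<rho> \<E>) f
          \<le> C * (real l)\<^sup>2 *
             (\<Sum>(x, y)\<in>{(x, y). x \<in> {0..int l - 1} \<and> y \<in> {0..int l - 1} \<and> \<bar>x - y\<bar> = 1}.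
                dirichlet_p \<kappa> (prod_meas \<kappa> \<rho> \<E>) f x y +
                dirichlet_e \<kappa> (prod_meas \<kappa> \<rho> \<E>) f x y)))"
proof -
  define m where "m = \<kappa> - 1"
  have \<kappa>: "\<kappa> = Suc m" and m: "0 < m" using assms by (simp_all add: m_def)
  \<comment> \<open>The factor 2 compensates the 1/2 in the Dirichlet forms.\<close>
  let ?C = "2 * (48 * (real m)\<^sup>2 + 7)"
  have main: "prob_space.variance (prod_meas \<kappa> \<rho> \<E>) f \<le> ?C * (real l)\<^sup>2 *
             (\<Sum>(x, y)\<in>{(x, y). x \<in> {0..int l - 1} \<and> y \<in> {0..int l - 1} \<and> \<bar>x - y\<bar> = 1}.
                dirichlet_p \<kappa> (prod_meas \<kappa> \<rho> \<E>) f x y + dirichlet_e \<kappa> (prod_meas \<kappa> \<rho> \<E>) f x y)"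
    if supp_f: "supported_in \<kappa> {0..int l - 1} f"
      and psi0: "\<And>\<rho> \<E>. \<rho> \<in> {0..1} \<Longrightarrow> \<E> \<in> {\<rho>..real \<kappa> * \<rho>} \<Longrightarrow> psi \<kappa> f \<rho> \<E> = 0"
      and \<rho>: "\<rho> \<in> {0..1}" and \<E>: "\<E> \<in> {\<rho>..real \<kappa> * \<rho>}"
    for l :: nat and f \<rho> \<E>
  proof -
    let ?I = "{0..int l - 1}"
    obtain q where q: "q \<in> {0..1}" and sw: "site_weight (Suc m) \<rho> \<E> = marginal m \<rho> q"
      using site_weight_marginal[OF m \<rho>] \<E> unfolding \<kappa> by blast
    interpret energy_segment m ?I "class_weight m \<rho> q l" l
      by unfold_locales (use m class_weight_nonneg[OF \<rho> q] in auto)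
    have int: "(LINT \<eta>|prod_meas \<kappa> r e. h \<eta>) = (\<Sum>\<eta>\<in>X. (\<Prod>x\<in>?I. marginal m r p (\<eta> x)) * h \<eta>)"
      if "r \<in> {0..1}" "p \<in> {0..1}" "site_weight (Suc m) r e = marginal m r p" "supported_in \<kappa> ?I h" for r p e h
      unfolding \<kappa> that(3)[symmetric]
      using that marginal_nonneg sum_marginal by (intro integral_prod_meas) (auto simp: \<kappa>)
    have intW: "(LINT \<eta>|prod_meas \<kappa> \<rho> \<E>. h \<eta>) = (\<Sum>\<eta>\<in>X. W \<eta> * h \<eta>)" if "supported_in \<kappa> ?I h" for h
      unfolding int[OF \<rho> q sw that] by (intro sum.cong refl) (simp only: prod_marginal card_I W_def)
    have zero: "(\<Sum>\<eta>\<in>{\<eta>\<in>X. card (supp \<eta>) = N \<and> energy \<eta> = E}. mult \<eta> * f \<eta>) = 0" for N E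
    proof (rule class_sums_zero)
      fix r p :: real assume r: "r \<in> {0<..1}" and p: "p \<in> {0..1}"
      \<comment> \<open>The inverse of \<open>energy_param\<close>: e / r - 1 = m p.\<close>
      define e where "e = r * (1 + real m * p)"
      have "r * (real m * p) \<le> r * (real m * 1)" using r p by (intro mult_left_mono) auto
      then have e: "e \<in> {r..real \<kappa> * r}" using r p by (simp add: e_def \<kappa> algebra_simps)
      have "energy_param (Suc m) r e = p" using r m by (simp add: energy_param_def e_def)
      then have "site_weight (Suc m) r e = marginal m r p"
        by (auto simp: fun_eq_iff site_weight_def marginal_def)
      then show "(\<Sum>\<eta>\<in>X. (\<Prod>x\<in>?I. marginal m r p (\<eta> x)) * f \<eta>) = 0"
        using int[of r p e f] psi0[OF _ e] r p supp_f by (simp add: psi_def)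
    qed
    have "(LINT \<eta>|prod_meas \<kappa> \<rho> \<E>. f \<eta>) = 0" using psi0[OF \<rho> \<E>] by (simp add: psi_def)
    then have "prob_space.variance (prod_meas \<kappa> \<rho> \<E>) f = (\<Sum>\<eta>\<in>X. W \<eta> * (f \<eta>)\<^sup>2)"
      using intW[OF supported_power2[OF supp_f]] by simp
    also have "\<dots> \<le> (48 * (real m)\<^sup>2 + 7) * (real l)\<^sup>2 *
        (\<Sum>b\<in>bonds. form_p f b (b + 1) + form_p f (b + 1) b + form_e f b (b + 1))"
      by (rule spectral_gap) (rule zero)
    \<comment> \<open>Adds the nonnegative energy forms from \<open>b + 1\<close> to
      \<open>b\<close>: the gap needs one direction of each bond, the sum over ordered pairs has
      both.\<close>
    also have "\<dots> \<le> (48 * (real m)\<^sup>2 + 7) * (real l)\<^sup>2 *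
        (\<Sum>b\<in>bonds. 2 * ((form_p f b (b + 1) + form_e f b (b + 1)) / 2 + (form_p f (b + 1) b + form_e f (b + 1) b) / 2))"
      using form_e_nonneg by (intro mult_left_mono sum_mono) (auto simp: field_simps)
    also have "\<dots> = ?C * (real l)\<^sup>2 *
        (\<Sum>b\<in>bonds. (form_p f b (b + 1) + form_e f b (b + 1)) / 2 + (form_p f (b + 1) b + form_e f (b + 1) b) / 2)"
      by (simp only: sum_distrib_left[symmetric] mult.assoc mult.left_commute[of _ 2])
    also have "(\<Sum>b\<in>bonds. (form_p f b (b + 1) + form_e f b (b + 1)) / 2 + (form_p f (b + 1) b + form_e f (b + 1) b) / 2)
        = (\<Sum>(x, y)\<in>{(x, y). x \<in> ?I \<and> y \<in> ?I \<and> \<bar>x - y\<bar> = 1}. (form_p f x y + form_e f x y) / 2)"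
      unfolding bonds_def by (rule sum_neighbour_pairs[symmetric]) simp
    also have "\<dots> = (\<Sum>(x, y)\<in>{(x, y). x \<in> ?I \<and> y \<in> ?I \<and> \<bar>x - y\<bar> = 1}.
        dirichlet_p \<kappa> (prod_meas \<kappa> \<rho> \<E>) f x y + dirichlet_e \<kappa> (prod_meas \<kappa> \<rho> \<E>) f x y)"
    proof (intro sum.cong refl, clarify)
      fix x y :: int assume xy: "x \<in> ?I" "y \<in> ?I"
      show "(form_p f x y + form_e f x y) / 2
        = dirichlet_p \<kappa> (prod_meas \<kappa> \<rho> \<E>) f x y + dirichlet_e \<kappa> (prod_meas \<kappa> \<rho> \<E>) f x y"
        using intW[OF supported_dirichlet_p[OF supp_f xy]] intW[OF supported_dirichlet_e[OF supp_f xy]]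
        by (simp add: dirichlet_p_def dirichlet_e_def form_p_def form_e_def exchange_def \<kappa> add_divide_distrib)
    qed
    finally show ?thesis .
  qed
  have "0 < ?C" by (simp add: add_nonneg_pos)
  then show ?thesis using main by (intro exI[of _ ?C]) blast
qed

end
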